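(* For integers $n\ge 1$ and $k\ge 0$, let $$\tilde\gamma_{n,k}(\mathbf{x}) := \sum_{D\in\tilde{\mathcal H}_{n,k}} s_D(\mathbf{x}),$$ where $s_D(\mathbf{x})$ is the skew Schur function of shape $D$. Then for all $n\ge 1$, $$\tilde Q_n(\mathbf{x},t)=\sum_{k=0}^{\lfloor n/2\rfloor}\tilde\gamma_{n,k}(\mathbf{x})\,t^k(1+t)^{n-2k}.$$ Consequently the polynomial $\tilde Q_n(\mathbf{x},t)$ is Schur-$\gamma$-positive.
   Context: Let $\mathbf{x}=(x_1,x_2,\dots)$, let $\Lambda$ be the $\mathbb{R}$-algebra of symmetric functions in $\mathbf{x}$, let $h_n(\mathbf{x})$ be the complete homogeneous symmetric function of degree $n$, and let $H(z):=\sum_{n\ge0}h_n(\mathbf{x})z^n$. The polynomials $Q_n(\mathbf{x},t)\in\Lambda[t]$ are defined by $$\sum_{n\ge0}Q_n(\mathbf{x},t)z^n:=\frac{(1-t)H(z)}{H(tz)-tH(z)},$$ and for $n\ge0$, $\tilde Q_n(\mathbf{x},t):=h_n(\mathbf{x})+t\sum_{m=1}^n h_{n-m}(\mathbf{x})Q_m(\mathbf{x},t)$. A skew hook is a connected skew diagram (English notation, considered up to translation) containing no $2\times2$ square. $\tilde{\mathcal H}_{n,k}$ is the set of skew hooks of size $n$ (i.e. with $n$ cells) for which $k$ columns have size $2$ and the remaining $n-2k$ columns have size $1$. A symmetric function is Schur-positive if its expansion in the basis of Schur functions has nonnegative coefficients. A polynomial $A(t)\in\Lambda[t]$ is Schur-$\gamma$-positive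 if for some $d$ there exist Schur-positive $\gamma_0,\dots,\gamma_{\lfloor d/2\rfloor}\in\Lambda$ such that $A(t)=\sum_{k=0}^{\lfloor d/2\rfloor}\gamma_kt^k(1+t)^{d-2k}$. *)

theory Defs
  imports
    Complex_Main
    "HOL-Library.Multiset"
    "HOL-Library.FuncSet"
    "HOL-Computational_Algebra.Polynomial"
    "HOL-Computational_Algebra.Formal_Power_Series"
begin

section \<open>Formal power series in countably many variables\<close>

text \<open>
  The monomial \<open>x\<^sub>i\<^sub>1 \<cdots> x\<^sub>i\<^sub>r\<close> is the multiset of the indices of its variables, so that the product
  of monomials is the sum of multisets and the degree is the size. The variables are indexed
  from \<open>0\<close>. A value of the type \<open>mpser\<close> is an arbitrary real formal power series; the symmetric
  functions are singled out below as the set \<open>sym_fun\<close>.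
\<close>

typedef mpser = "UNIV :: (nat multiset \<Rightarrow> real) set"
  morphisms mcoeff Abs_mpser
  by simp

lemma mcoeff_Abs [simp]: "mcoeff (Abs_mpser f) = f"
  by (simp add: Abs_mpser_inverse)

lemma mpser_eqI: "(\<And>m. mcoeff f m = mcoeff g m) \<Longrightarrow> f = g"
  by (metis ext mcoeff_inject)

lemma finite_add_decomp: "finite {(a, b). a + b = (m :: nat multiset)}"
proof (induction m)
  case empty
  have "{(a, b). a + b = ({#} :: nat multiset)} = {({#}, {#})}" by auto
  then show ?case by simp
next
  case (add x m)
  let ?S = "{(a, b). a + b = m}"
  have "{(a, b). a + b = add_mset x m}
      \<subseteq> (\<lambda>(a, b). (add_mset x a, b)) ` ?S \<union> (\<lambda>(a, b). (a, add_mset x b)) ` ?S"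
  proof
    fix p assume "p \<in> {(a, b). a + b = add_mset x m}"
    then obtain a b where p: "p = (a, b)" and *: "a + b = add_mset x m" by blast
    show "p \<in> (\<lambda>(a, b). (add_mset x a, b)) ` ?S \<union> (\<lambda>(a, b). (a, add_mset x b)) ` ?S"
    proof (cases "x \<in># a")
      case True
      then obtain c where "a = add_mset x c" by (metis multi_member_split)
      with * p show ?thesis by force
    next
      case False
      then have "x \<in># b" using * by (metis union_iff union_single_eq_member)
      then obtain d where "b = add_mset x d" by (metis multi_member_split)
      with * p show ?thesis by force
    qed
  qed
  then show ?case using add by (meson finite_UnI finite_imageI finite_subset)
qed

instantiation mpser :: comm_ring_1
begin

definition "0 = Abs_mpser (\<lambda>m. 0)"
definition "1 = Abs_mpser (\<lambda>m. if m = {#} then 1 else 0)"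
definition "f + g = Abs_mpser (\<lambda>m. mcoeff f m + mcoeff g m)"
definition "f - g = Abs_mpser (\<lambda>m. mcoeff f m - mcoeff g m)"
definition "- f = Abs_mpser (\<lambda>m. - mcoeff f m)"
definition "f * g = Abs_mpser (\<lambda>m. \<Sum>(a, b) | a + b = m. mcoeff f a * mcoeff g b)"

instance
proof
  fix f g h :: mpser
  note defs = zero_mpser_def one_mpser_def plus_mpser_def minus_mpser_def uminus_mpser_def
    times_mpser_def
  have finp: "finite {p :: nat multiset \<times> nat multiset. fst p + snd p = m}" for m
    using finite_add_decomp[of m] by (simp add: case_prod_unfold)
  show "f * g * h = f * (g * h)"
  proof (rule mpser_eqI)
    fix m
    let ?t = "\<lambda>a b c. mcoeff f a * mcoeff g b * mcoeff h c"
    have "mcoeff (f * g * h) m =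
        (\<Sum>p | fst p + snd p = m. \<Sum>q | fst q + snd q = fst p. ?t (fst q) (snd q) (snd p))"
      by (simp add: times_mpser_def case_prod_unfold sum_distrib_right)
    also have "\<dots> = (\<Sum>(p, q)\<in>Sigma {p. fst p + snd p = m} (\<lambda>p. {q. fst q + snd q = fst p}).
        ?t (fst q) (snd q) (snd p))"
      by (rule sum.Sigma) (use finp in auto)
    also have "\<dots> = (\<Sum>(p, q)\<in>Sigma {p. fst p + snd p = m} (\<lambda>p. {q. fst q + snd q = snd p}).
        ?t (fst p) (fst q) (snd q))"
      by (rule sum.reindex_bij_witness[where
            i = "\<lambda>(p, q). ((fst p + fst q, snd q), (fst p, fst q))" and
            j = "\<lambda>(p, q). ((fst q, snd q + snd p), (snd q, snd p))"])
         (auto simp: add.assoc)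
    also have "\<dots> =
        (\<Sum>p | fst p + snd p = m. \<Sum>q | fst q + snd q = snd p. ?t (fst p) (fst q) (snd q))"
      by (rule sum.Sigma[symmetric]) (use finp in auto)
    also have "\<dots> = mcoeff (f * (g * h)) m"
      by (simp add: times_mpser_def case_prod_unfold sum_distrib_left mult.assoc)
    finally show "mcoeff (f * g * h) m = mcoeff (f * (g * h)) m" .
  qed
  show "f * g = g * f"
    unfolding times_mpser_def
    by (rule arg_cong[where f = Abs_mpser], rule ext,
        rule sum.reindex_bij_witness[where i = prod.swap and j = prod.swap])
       (auto simp: add.commute mult.commute)
  show "1 * f = f"
  proof (rule mpser_eqI)
    fix m
    have "mcoeff (1 * f) m
        = (\<Sum>p | fst p + snd p = m. if p = ({#}, m) then mcoeff f m else 0)"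
      by (auto simp: times_mpser_def one_mpser_def case_prod_unfold intro!: sum.cong)
    also have "\<dots> = mcoeff f m"
      by (subst sum.delta[OF finp]) simp
    finally show "mcoeff (1 * f) m = mcoeff f m" .
  qed
  show "(f + g) * h = f * h + g * h"
    by (rule mpser_eqI)
       (simp add: times_mpser_def plus_mpser_def case_prod_unfold sum.distrib algebra_simps)
  have "mcoeff 0 {#} \<noteq> mcoeff 1 {#}" by (simp add: defs)
  then show "(0 :: mpser) \<noteq> 1" by metis
qed (rule mpser_eqI; simp add: zero_mpser_def plus_mpser_def minus_mpser_def uminus_mpser_def
      algebra_simps)+

end

instantiation mpser :: real_algebra_1
begin

definition "scaleR c f = Abs_mpser (\<lambda>m. c * mcoeff f m)"

instance
proof
  fix f g :: mpser and c :: real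
  show "scaleR c f * g = scaleR c (f * g)"
    by (rule mpser_eqI)
       (simp add: times_mpser_def scaleR_mpser_def case_prod_unfold sum_distrib_left mult.assoc)
  show "f * scaleR c g = scaleR c (f * g)"
    by (rule mpser_eqI)
       (simp add: times_mpser_def scaleR_mpser_def case_prod_unfold sum_distrib_left mult_ac)
qed (rule mpser_eqI; simp add: plus_mpser_def scaleR_mpser_def algebra_simps)+

end


section \<open>Symmetric functions\<close>

definition sym_fun :: "mpser set" where
  "sym_fun = {f.
     (\<forall>\<pi> m. bij \<pi> \<longrightarrow> mcoeff f (image_mset \<pi> m) = mcoeff f m) \<and>
     (\<exists>d. \<forall>m. mcoeff f m \<noteq> 0 \<longrightarrow> size m \<le> d)}"

definition hsym :: "nat \<Rightarrow> mpser" where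
  "hsym n = Abs_mpser (\<lambda>m. if size m = n then 1 else 0)"


section \<open>The polynomials \<open>Q\<^sub>n\<close> and their variants\<close>

definition H_series :: "mpser poly fps" where
  "H_series = Abs_fps (\<lambda>n. [:hsym n:])"

abbreviation tvar :: "mpser poly" where
  "tvar \<equiv> [:0, 1:]"

text \<open>
  The denominator \<open>H(tz) - t H(z)\<close> has constant term \<open>1 - t\<close>, which is not a unit of \<open>\<Lambda>[t]\<close>. The
  quotient is therefore defined by cross-multiplication; \<open>Q_series_ex1\<close> shows that this
  determines it.
\<close>

definition Q_series :: "mpser poly fps" where
  "Q_series = (THE F.
     F * ((H_series oo (fps_const tvar * fps_X)) - fps_const tvar * H_series)
     = fps_const (1 - tvar) * H_series)"

lemma one_minus_tvar_cancel:
  assumes "(1 - tvar) * p = 0"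
  shows "p = 0"
proof -
  have e: "1 - tvar = ([:1, -1:] :: mpser poly)"
    by (simp add: one_pCons)
  have "coeff ([:1, -1:] * p) (degree [:1, -1 :: mpser:] + degree p) = - lead_coeff p"
    by (subst coeff_mult_degree_sum) simp
  with assms show ?thesis by (simp add: e)
qed

lemma Q_series_ex1:
  "\<exists>!F. F * ((H_series oo (fps_const tvar * fps_X)) - fps_const tvar * H_series)
     = fps_const (1 - tvar) * H_series"
proof -
  define D :: "mpser poly fps" where
    "D = Abs_fps (\<lambda>n. if n = 0 then 1 else - (\<Sum>i=1..<n. tvar ^ i) * [:hsym n:])"
  let ?E = "fps_right_inverse D 1"
  have h0: "hsym 0 = 1" by (rule mpser_eqI) (simp add: hsym_def one_mpser_def)
  have geo: "(1 - t) * (\<Sum>i=1..<n. t ^ i) = t - t ^ n" if "n \<noteq> 0" for n and t :: "mpser poly"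
  proof -
    have "0 < n" using that by simp
    then show ?thesis
    proof (induction n rule: nat_induct_non_zero)
      case (Suc n)
      have "(1 - t) * (\<Sum>i=1..<Suc n. t ^ i) = (1 - t) * (\<Sum>i=1..<n. t ^ i) + (1 - t) * t ^ n"
        using Suc.hyps by (simp add: distrib_left)
      with Suc.IH show ?case by (simp add: left_diff_distrib)
    qed simp
  qed
  have den: "(H_series oo (fps_const tvar * fps_X)) - fps_const tvar * H_series
      = fps_const (1 - tvar) * D"
  proof (rule fps_ext)
    fix n
    show "fps_nth ((H_series oo (fps_const tvar * fps_X)) - fps_const tvar * H_series) n
        = fps_nth (fps_const (1 - tvar) * D) n"
    proof (cases "n = 0")
      case True
      have c: "[:hsym 0:] = 1" by (simp add: h0 one_pCons)
      have d: "fps_nth D 0 = 1" by (simp add: D_def)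
      show ?thesis
        by (simp only: True fps_compose_linear H_series_def fps_sub_nth fps_mult_left_const_nth
            fps_nth_Abs_fps c d power_0 mult_1_right)
    next
      case False
      have "fps_nth (fps_const (1 - tvar) * D) n = - ((1 - tvar) * (\<Sum>i=1..<n. tvar ^ i)) * [:hsym n:]"
        using False by (simp only: D_def fps_mult_left_const_nth fps_nth_Abs_fps if_False
            mult.assoc mult_minus_left mult_minus_right)
      also have "\<dots> = (tvar ^ n - tvar) * [:hsym n:]"
        by (simp only: geo[OF False] minus_diff_eq)
      also have "\<dots> = fps_nth ((H_series oo (fps_const tvar * fps_X)) - fps_const tvar * H_series) n"
        by (simp only: fps_compose_linear H_series_def fps_sub_nth fps_mult_left_const_nth
            fps_nth_Abs_fps left_diff_distrib)
      finally show ?thesis by (rule sym)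
    qed
  qed
  have inv: "D * ?E = 1"
    by (rule fps_right_inverse) (simp add: D_def)
  show ?thesis
  proof (rule ex1I[of _ "H_series * ?E"])
    show "H_series * ?E * ((H_series oo (fps_const tvar * fps_X)) - fps_const tvar * H_series)
        = fps_const (1 - tvar) * H_series"
    proof -
      have "H_series * ?E * (fps_const (1 - tvar) * D) = fps_const (1 - tvar) * H_series * (D * ?E)"
        by (simp only: mult_ac)
      then show ?thesis unfolding den inv by (simp only: mult_1_right)
    qed
  next
    fix F
    assume "F * ((H_series oo (fps_const tvar * fps_X)) - fps_const tvar * H_series)
        = fps_const (1 - tvar) * H_series"
    then have "fps_const (1 - tvar) * (F * D) = fps_const (1 - tvar) * H_series"
      unfolding den by (simp only: mult_ac)
    then have "fps_const (1 - tvar) * (F * D - H_series) = 0"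
      by (simp only: right_diff_distrib) simp
    then have "(1 - tvar) * fps_nth (F * D - H_series) n = 0" for n
      by (subst fps_mult_left_const_nth[symmetric]) simp
    then have "fps_nth (F * D - H_series) n = 0" for n
      using one_minus_tvar_cancel by blast
    then have "F * D = H_series"
      by (intro fps_ext) simp
    then have "H_series * ?E = F * (D * ?E)"
      by (simp flip: mult.assoc)
    then show "F = H_series * ?E"
      unfolding inv by (simp only: mult_1_right)
  qed
qed

definition Qpoly :: "nat \<Rightarrow> mpser poly" where
  "Qpoly n = fps_nth Q_series n"

definition Qtilde :: "nat \<Rightarrow> mpser poly" where
  "Qtilde n = [:hsym n:] + tvar * (\<Sum>m=1..n. [:hsym (n - m):] * Qpoly m)"


section \<open>Skew diagrams and skew Schur functions\<close>

definition is_partition :: "(nat \<Rightarrow> nat) \<Rightarrow> bool" where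
  "is_partition l \<longleftrightarrow> antimono l \<and> finite {i. l i \<noteq> 0}"

text \<open>
  Cells are pairs (row, column), both starting at \<open>0\<close>; in English notation the row index increases
  downwards.
\<close>

type_synonym diagram = "(nat \<times> nat) set"

definition skew_cells :: "(nat \<Rightarrow> nat) \<Rightarrow> (nat \<Rightarrow> nat) \<Rightarrow> diagram" where
  "skew_cells l \<mu> = {(i, j). \<mu> i \<le> j \<and> j < l i}"

definition skew_diagram :: "diagram \<Rightarrow> bool" where
  "skew_diagram D \<longleftrightarrow>
     (\<exists>l \<mu>. is_partition l \<and> is_partition \<mu> \<and> (\<forall>i. \<mu> i \<le> l i) \<and> D = skew_cells l \<mu>)"

text \<open>
  Fillings are extensional functions on the diagram, so each tableau is counted once.
\<close>

definition ssyt :: "diagram \<Rightarrow> (nat \<times> nat \<Rightarrow> nat) set" where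
  "ssyt D = {T \<in> D \<rightarrow>\<^sub>E UNIV.
     (\<forall>i j j'. (i, j) \<in> D \<and> (i, j') \<in> D \<and> j < j' \<longrightarrow> T (i, j) \<le> T (i, j')) \<and>
     (\<forall>i i' j. (i, j) \<in> D \<and> (i', j) \<in> D \<and> i < i' \<longrightarrow> T (i, j) < T (i', j))}"

definition skew_schur :: "diagram \<Rightarrow> mpser" where
  "skew_schur D = Abs_mpser (\<lambda>m. real (card {T \<in> ssyt D. image_mset T (mset_set D) = m}))"

definition schur :: "(nat \<Rightarrow> nat) \<Rightarrow> mpser" where
  "schur l = skew_schur (skew_cells l (\<lambda>_. 0))"

definition schur_positive :: "mpser \<Rightarrow> bool" where
  "schur_positive f \<longleftrightarrow> f \<in> sym_fun \<and>
     (\<exists>P c. finite P \<and> (\<forall>l\<in>P. is_partition l \<and> c l \<ge> (0 :: real)) \<and>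
        f = (\<Sum>l\<in>P. c l *\<^sub>R schur l))"

definition schur_gamma_positive :: "mpser poly \<Rightarrow> bool" where
  "schur_gamma_positive A \<longleftrightarrow> (\<forall>i. coeff A i \<in> sym_fun) \<and>
     (\<exists>d \<gamma>. (\<forall>k\<le>d div 2. schur_positive (\<gamma> k)) \<and>
        A = (\<Sum>k=0..d div 2. smult (\<gamma> k) (tvar ^ k * (1 + tvar) ^ (d - 2 * k))))"


section \<open>Skew hooks\<close>

definition adjacent_cells :: "nat \<times> nat \<Rightarrow> nat \<times> nat \<Rightarrow> bool" where
  "adjacent_cells c d \<longleftrightarrow>
     (fst c = fst d \<and> (snd d = Suc (snd c) \<or> snd c = Suc (snd d))) \<or>
     (snd c = snd d \<and> (fst d = Suc (fst c) \<or> fst c = Suc (fst d)))"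

definition connected_diagram :: "diagram \<Rightarrow> bool" where
  "connected_diagram D \<longleftrightarrow>
     (\<forall>c\<in>D. \<forall>d\<in>D. (c, d) \<in> {(x, y). x \<in> D \<and> y \<in> D \<and> adjacent_cells x y}\<^sup>*)"

definition skew_hook :: "diagram \<Rightarrow> bool" where
  "skew_hook D \<longleftrightarrow> skew_diagram D \<and> D \<noteq> {} \<and> connected_diagram D \<and>
     \<not> (\<exists>i j. {(i, j), (i, Suc j), (Suc i, j), (Suc i, Suc j)} \<subseteq> D)"

text \<open>
  Diagrams up to translation are encoded by the representative that meets row \<open>0\<close> and column \<open>0\<close>;
  \<open>skew_hook_normalized_ex1\<close> shows that each translation class of skew hooks has exactly one.
\<close>

definition normalized :: "diagram \<Rightarrow> bool" where
  "normalized D \<longleftrightarrow> (\<exists>j. (0, j) \<in> D) \<and> (\<exists>i. (i, 0) \<in> D)"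

definition translate :: "nat \<Rightarrow> nat \<Rightarrow> diagram \<Rightarrow> diagram" where
  "translate a b D = (\<lambda>(i, j). (i + a, j + b)) ` D"

lemma skew_hook_normalized_ex1:
  assumes "skew_hook D"
  shows "\<exists>!D'. skew_hook D' \<and> normalized D' \<and> (\<exists>a b. D = translate a b D')"
proof -
  define a where "a = (LEAST i. \<exists>j. (i, j) \<in> D)"
  define b where "b = (LEAST j. \<exists>i. (i, j) \<in> D)"
  define E where "E = {(i, j). (i + a, j + b) \<in> D}"
  from assms obtain i0 j0 where ne: "(i0, j0) \<in> D"
    by (auto simp: skew_hook_def)
  have a1: "\<exists>j. (a, j) \<in> D"
    unfolding a_def by (rule LeastI_ex) (use ne in blast)
  have b1: "\<exists>i. (i, b) \<in> D"
    unfolding b_def by (rule LeastI_ex) (use ne in blast)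
  have a2: "a \<le> i" if "(i, j) \<in> D" for i j
    unfolding a_def by (rule Least_le) (use that in blast)
  have b2: "b \<le> j" if "(i, j) \<in> D" for i j
    unfolding b_def by (rule Least_le) (use that in blast)
  have DE: "D = translate a b E"
  proof (rule set_eqI)
    fix p :: "nat \<times> nat"
    obtain i j where p: "p = (i, j)" by (cases p)
    show "p \<in> D \<longleftrightarrow> p \<in> translate a b E"
    proof
      assume "p \<in> D"
      then have "(i - a, j - b) \<in> E" "i = i - a + a" "j = j - b + b"
        using a2[of i j] b2[of i j] p by (auto simp: E_def)
      then show "p \<in> translate a b E"
        unfolding translate_def p by (metis (mono_tags, lifting) case_prod_conv image_eqI)
    qed (auto simp: translate_def E_def)
  qed
  have "normalized E"
    unfolding normalized_def
  proof
    from a1 obtain j where "(a, j) \<in> D" ..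
    with b2[of a j] have "(0, j - b) \<in> E" by (simp add: E_def)
    then show "\<exists>j. (0, j) \<in> E" ..
    from b1 obtain i where "(i, b) \<in> D" ..
    with a2[of i b] have "(i - a, 0) \<in> E" by (simp add: E_def)
    then show "\<exists>i. (i, 0) \<in> E" ..
  qed
  moreover have "skew_hook E"
    unfolding skew_hook_def
  proof (intro conjI)
    from assms obtain l \<mu> where l: "is_partition l" "is_partition \<mu>" "\<forall>i. \<mu> i \<le> l i"
      and D: "D = skew_cells l \<mu>"
      by (auto simp: skew_hook_def skew_diagram_def)
    have sh: "is_partition (\<lambda>i. f (i + a) - b)" if "is_partition f" for f
      unfolding is_partition_def
    proof
      show "antimono (\<lambda>i. f (i + a) - b)"
        using that by (auto simp: is_partition_def antimono_def intro!: diff_le_mono)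
      have "finite ((\<lambda>i. i + a) -` {i. f i \<noteq> 0})"
        using that by (intro finite_vimageI) (auto simp: is_partition_def)
      then show "finite {i. f (i + a) - b \<noteq> 0}"
        by (rule rev_finite_subset) auto
    qed
    have "E = skew_cells (\<lambda>i. l (i + a) - b) (\<lambda>i. \<mu> (i + a) - b)"
      by (auto simp: E_def D skew_cells_def)
    with sh[OF l(1)] sh[OF l(2)] l(3) show "skew_diagram E"
      unfolding skew_diagram_def using diff_le_mono by blast
    show "E \<noteq> {}" using DE ne by (auto simp: translate_def)
    show "\<not> (\<exists>i j. {(i, j), (i, Suc j), (Suc i, j), (Suc i, Suc j)} \<subseteq> E)"
      using assms by (auto simp: skew_hook_def E_def)
    let ?R = "\<lambda>D. {(x, y). x \<in> D \<and> y \<in> D \<and> adjacent_cells x y}"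
    let ?f = "\<lambda>p :: nat \<times> nat. (fst p - a, snd p - b)"
    show "connected_diagram E"
      unfolding connected_diagram_def
    proof (intro ballI)
      fix c d assume cd: "c \<in> E" "d \<in> E"
      let ?g = "\<lambda>p :: nat \<times> nat. (fst p + a, snd p + b)"
      have "?g c \<in> D" "?g d \<in> D" using cd by (auto simp: E_def)
      then have "(?g c, ?g d) \<in> (?R D)\<^sup>*"
        using assms unfolding skew_hook_def connected_diagram_def by blast
      then have "(?f (?g c), ?f (?g d)) \<in> (?R E)\<^sup>*"
      proof (induction rule: rtrancl_induct)
        case (step y z)
        then have yz: "y \<in> D" "z \<in> D" "adjacent_cells y z" by auto
        have "(?f y, ?f z) \<in> ?R E"
          using yz a2[of "fst y" "snd y"] a2[of "fst z" "snd z"]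
            b2[of "fst y" "snd y"] b2[of "fst z" "snd z"]
          by (auto simp: E_def adjacent_cells_def)
        with step.IH show ?case by (rule rtrancl_into_rtrancl)
      qed simp
      then show "(c, d) \<in> (?R E)\<^sup>*" by simp
    qed
  qed
  moreover have "E' = E" if n: "normalized E'" and D: "D = translate a' b' E'" for E' a' b'
  proof -
    have "a' = a"
    proof (rule antisym)
      from a1 show "a' \<le> a" by (auto simp: D translate_def)
      from n obtain j where "(0, j) \<in> E'" by (auto simp: normalized_def)
      then have "(a', j + b') \<in> D" unfolding D translate_def by force
      then show "a \<le> a'" by (rule a2)
    qed
    moreover have "b' = b"
    proof (rule antisym)
      from b1 show "b' \<le> b" by (auto simp: D translate_def)
      from n obtain i where "(i, 0) \<in> E'" by (auto simp: normalized_def)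
      then have "(i + a', b') \<in> D" unfolding D translate_def by force
      then show "b \<le> b'" by (rule b2)
    qed
    moreover have "inj (\<lambda>(i, j). (i + a :: nat, j + b :: nat))"
      by (auto simp: inj_def)
    ultimately show ?thesis
      using D DE unfolding translate_def by (metis inj_image_eq_iff)
  qed
  ultimately show ?thesis
    using DE by blast
qed

definition column :: "diagram \<Rightarrow> nat \<Rightarrow> nat set" where
  "column D j = {i. (i, j) \<in> D}"

definition skew_hooks :: "nat \<Rightarrow> nat \<Rightarrow> diagram set" where
  "skew_hooks n k = {D. skew_hook D \<and> normalized D \<and> card D = n \<and>
     (\<forall>j. column D j \<noteq> {} \<longrightarrow> card (column D j) \<in> {1, 2}) \<and>
     card {j. card (column D j) = 2} = k \<and>
     card {j. card (column D j) = 1} + 2 * k = n}"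

lemma finite_skew_hooks: "finite (skew_hooks n k)"
proof (cases "n = 0")
  case True
  have "finite D" if "skew_diagram D" for D
  proof -
    from that obtain l \<mu> where l: "is_partition l" and D: "D = skew_cells l \<mu>"
      by (auto simp: skew_diagram_def)
    have "D \<subseteq> (SIGMA i:{i. l i \<noteq> 0}. {..<l i})"
      by (auto simp: D skew_cells_def)
    with l show ?thesis
      by (intro finite_subset[OF _ finite_SigmaI]) (auto simp: is_partition_def)
  qed
  then have "skew_hooks n k = {}"
    using True by (auto simp: skew_hooks_def skew_hook_def)
  then show ?thesis by simp
next
  case False
  have "D \<subseteq> {..<n} \<times> {..<n}" if D: "D \<in> skew_hooks n k" for D
  proof
    fix c assume c: "c \<in> D"
    let ?R = "{(x, y). x \<in> D \<and> y \<in> D \<and> adjacent_cells x y}"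
    from D have card: "card D = n" and conn: "connected_diagram D" and "normalized D"
      by (auto simp: skew_hooks_def skew_hook_def)
    then obtain i0 j0 where z: "(0, j0) \<in> D" "(i0, 0) \<in> D"
      by (auto simp: normalized_def)
    have fin: "finite D" using card False by (intro card_ge_0_finite) simp
    have "((0, j0), c) \<in> ?R\<^sup>*"
      using conn z c unfolding connected_diagram_def by blast
    then have "{..fst c} \<subseteq> fst ` D"
    proof (induction rule: rtrancl_induct)
      case base
      from z(1) show ?case by force
    next
      case (step y w)
      then have "fst w \<in> fst ` D" "fst w \<le> Suc (fst y)"
        by (auto simp: adjacent_cells_def)
      then have "{..fst w} \<subseteq> insert (fst w) {..fst y}" by auto
      with step.IH \<open>fst w \<in> fst ` D\<close> show ?case by blast
    qed
    then have "card {..fst c} \<le> card D"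
      by (rule surj_card_le[OF fin])
    moreover have "((i0, 0), c) \<in> ?R\<^sup>*"
      using conn z c unfolding connected_diagram_def by blast
    then have "{..snd c} \<subseteq> snd ` D"
    proof (induction rule: rtrancl_induct)
      case base
      from z(2) show ?case by force
    next
      case (step y w)
      then have "snd w \<in> snd ` D" "snd w \<le> Suc (snd y)"
        by (auto simp: adjacent_cells_def)
      then have "{..snd w} \<subseteq> insert (snd w) {..snd y}" by auto
      with step.IH \<open>snd w \<in> snd ` D\<close> show ?case by blast
    qed
    then have "card {..snd c} \<le> card D"
      by (rule surj_card_le[OF fin])
    ultimately show "c \<in> {..<n} \<times> {..<n}"
      using card by (cases c) simp
  qed
  then have "skew_hooks n k \<subseteq> Pow ({..<n} \<times> {..<n})" by blast
  then show ?thesis by (rule finite_subset) simp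
qed

definition gamma_tilde :: "nat \<Rightarrow> nat \<Rightarrow> mpser" where
  "gamma_tilde n k = (\<Sum>D\<in>skew_hooks n k. skew_schur D)"

end

theory Submission
  imports Defs
begin

text \<open>
  Reading a ribbon from its bottom left to its top right cell turns its tableaux into words with a
  prescribed descent set, and a skew hook belongs to \<open>\<H>\<^sub>n\<^sub>,\<^sub>k\<close> iff its words have \<open>k\<close> descents, no two of
  them adjacent. Cutting a word into two gives \<open>r\<^sub>b r\<^sub>c = r\<^sub>b\<^sub>T\<^sub>c + r\<^sub>b\<^sub>F\<^sub>c\<close>, where \<open>T\<close> and \<open>F\<close> say whether there is
  a descent at the cut. Splitting off an initial decreasing run with this rule shows that the
  generating function of the right hand side is inverse to \<open>(E(-z) - t E(-tz)) / (1 - t)\<close>; as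
  \<open>E(-z) H(z) = 1\<close>, it equals \<open>(1 - t) H(z) H(tz) / (H(tz) - t H(z))\<close>, which is also the generating
  function of the left hand side.

  For Schur positivity, the Pieri rule is proved by induction on the number of variables with a
  local growth rule. Both the product of a Schur function with a ribbon function and the sum of
  Schur functions over the standard tableaux with the corresponding descent set satisfy the product
  rule above, so the Pieri rule implies that they agree.
\<close>

section \<open>Weight enumerators and words\<close>

text \<open>The weights have a hidden factorization. Let x mark columns of size 1 and y columns of
  size 2. A column of m cells put in front of a skew hook either stays a column of its own or fuses
  with a first column of size 1 or 2, so multiplying by e_m acts like 1 + xS + yS^2, where S raises
  the size of the first column by one. Coefficients of 1/(1 + xz + yz^2) therefore make the
  alternating sum telescope. For x = 1 + t and y = t the denominator is (1 + z)(1 + tz), and partial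
  fractions produce E(-z) and E(-tz) with the common divisor 1 - t; this is where the basis t^k (1 +
  t)^(n - 2k) comes from. The obstacle is that 1 - t is not a unit of the polynomial ring. Every
  identity between the series is kept multiplied by 1 - t, and the factor is cancelled only at the
  end, coefficient by coefficient.\<close>

definition enumerator :: "'a set \<Rightarrow> ('a \<Rightarrow> nat multiset) \<Rightarrow> mpser" where
  "enumerator A f = Abs_mpser (\<lambda>m. real (card {x \<in> A. f x = m}))"

lemma mcoeff_enumerator: "mcoeff (enumerator A f) m = real (card {x \<in> A. f x = m})"
  by (simp add: enumerator_def)

lemma mcoeff_zero [simp]: "mcoeff 0 m = 0"
  by (simp add: zero_mpser_def)

lemma mcoeff_one: "mcoeff 1 m = (if m = {#} then 1 else 0)"
  by (simp add: one_mpser_def)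

lemma mcoeff_add [simp]: "mcoeff (f + g) m = mcoeff f m + mcoeff g m"
  by (simp add: plus_mpser_def)

lemma mcoeff_diff [simp]: "mcoeff (f - g) m = mcoeff f m - mcoeff g m"
  by (simp add: minus_mpser_def)

lemma mcoeff_sum: "mcoeff (sum f A) m = (\<Sum>x\<in>A. mcoeff (f x) m)"
  by (induction A rule: infinite_finite_induct) auto

lemma mcoeff_mult: "mcoeff (f * g) m = (\<Sum>(a, b) | a + b = m. mcoeff f a * mcoeff g b)"
  by (simp add: times_mpser_def)

text \<open>A monomial has only finitely many factorizations, and each contributes a product of two
  fibres. Finite fibres make \<open>card\<close> an honest count, as it is 0 on infinite
  sets.\<close>

lemma enumerator_Times:
  assumes "\<And>m. finite {x \<in> A. f x = m}" "\<And>m. finite {y \<in> B. g y = m}"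
  shows "enumerator A f * enumerator B g = enumerator (A \<times> B) (\<lambda>(x, y). f x + g y)"
proof (rule mpser_eqI)
  fix m
  let ?S = "\<lambda>p. {x \<in> A. f x = fst p} \<times> {y \<in> B. g y = snd p}"
  let ?I = "{p :: nat multiset \<times> nat multiset. fst p + snd p = m}"
  have "{x \<in> A \<times> B. (case x of (x, y) \<Rightarrow> f x + g y) = m} = (\<Union>p\<in>?I. ?S p)"
    by auto
  moreover have "card (\<Union>p\<in>?I. ?S p) = (\<Sum>p\<in>?I. card (?S p))"
    by (rule card_UN_disjoint) (use assms finite_add_decomp[of m] in \<open>auto simp: case_prod_unfold\<close>)
  ultimately show "mcoeff (enumerator A f * enumerator B g) m =
      mcoeff (enumerator (A \<times> B) (\<lambda>(x, y). f x + g y)) m"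
    by (simp add: mcoeff_mult mcoeff_enumerator card_cartesian_product case_prod_unfold)
qed

lemma enumerator_bij_betw:
  assumes "bij_betw h A B" "\<And>x. x \<in> A \<Longrightarrow> g (h x) = f x"
  shows "enumerator A f = enumerator B g"
proof (rule mpser_eqI)
  fix m
  have "bij_betw h {x \<in> A. f x = m} {y \<in> B. g y = m}"
    using assms by (auto simp: bij_betw_def inj_on_def)
  then show "mcoeff (enumerator A f) m = mcoeff (enumerator B g) m"
    by (simp add: mcoeff_enumerator bij_betw_same_card)
qed

lemma enumerator_Un:
  assumes "A \<inter> B = {}" "\<And>m. finite {x \<in> A. f x = m}" "\<And>m. finite {x \<in> B. f x = m}"
  shows "enumerator (A \<union> B) f = enumerator A f + enumerator B f"
proof (rule mpser_eqI)
  fix m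
  have "{x \<in> A \<union> B. f x = m} = {x \<in> A. f x = m} \<union> {x \<in> B. f x = m}" by auto
  with assms show "mcoeff (enumerator (A \<union> B) f) m = mcoeff (enumerator A f + enumerator B f) m"
    by (simp add: mcoeff_enumerator) (subst card_Un_disjoint, auto)
qed

section \<open>Words with a prescribed pattern of comparisons\<close>

definition steps :: "('a \<Rightarrow> 'a \<Rightarrow> 'b) \<Rightarrow> 'a list \<Rightarrow> 'b list" where
  "steps R w = map2 R w (tl w)"

lemma length_steps [simp]: "length (steps R w) = length w - 1"
  by (simp add: steps_def)

lemma nth_steps: "Suc i < length w \<Longrightarrow> steps R w ! i = R (w ! i) (w ! Suc i)"
  by (simp add: steps_def nth_tl)

lemma steps_simps [simp]:
  "steps R [] = []" "steps R [x] = []" "steps R (x # y # w) = R x y # steps R (y # w)"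
  by (simp_all add: steps_def)

lemma steps_append:
  assumes "u \<noteq> []" "v \<noteq> []"
  shows "steps R (u @ v) = steps R u @ R (last u) (hd v) # steps R v"
  using assms
proof (induction u rule: induct_list012)
  case (2 x)
  then show ?case by (cases v) auto
qed auto

text \<open>Excluding the empty word matters because its list of steps is also \<open>[]\<close>.
  The relation is left open for two uses: \<open>(>)\<close> for readings of ribbon tableaux and
  \<open>(<)\<close> for row words of standard tableaux.\<close>

definition words :: "('a \<Rightarrow> 'a \<Rightarrow> 'b) \<Rightarrow> 'b list \<Rightarrow> 'a list set" where
  "words R b = {w. w \<noteq> [] \<and> steps R w = b}"

lemma words_length: "w \<in> words R b \<Longrightarrow> length w = Suc (length b)"
  by (cases w) (auto simp: words_def)

lemma words_eq_nth:
  "words R b = {w. length w = Suc (length b) \<and> (\<forall>i<length b. R (w ! i) (w ! Suc i) = b ! i)}"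
proof (intro set_eqI iffI)
  fix w assume w: "w \<in> words R b"
  then have b: "b = steps R w" by (simp add: words_def)
  show "w \<in> {w. length w = Suc (length b) \<and> (\<forall>i<length b. R (w ! i) (w ! Suc i) = b ! i)}"
    using words_length[OF w] by (simp add: b nth_steps)
next
  fix w assume "w \<in> {w. length w = Suc (length b) \<and> (\<forall>i<length b. R (w ! i) (w ! Suc i) = b ! i)}"
  then have len: "length w = Suc (length b)" and nth: "\<And>i. i < length b \<Longrightarrow> R (w ! i) (w ! Suc i) = b ! i"
    by auto
  have "steps R w = b"
    by (rule nth_equalityI) (use len nth in \<open>simp_all add: nth_steps\<close>)
  moreover have "w \<noteq> []" using len by auto
  ultimately show "w \<in> words R b" by (simp add: words_def)
qed

text \<open>Concatenation adds one comparison, at the cut, whose value d is free; the inverse cuts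
  after \<open>Suc (length b)\<close> letters, which does not depend on d.\<close>

lemma bij_betw_append_words:
  "bij_betw (\<lambda>(u, v). u @ v) (words R b \<times> words R c) (\<Union>d. words R (b @ d # c))"
proof (rule bij_betw_byWitness[where f' = "\<lambda>w. (take (Suc (length b)) w, drop (Suc (length b)) w)"])
  show "\<forall>a\<in>words R b \<times> words R c.
      (\<lambda>w. (take (Suc (length b)) w, drop (Suc (length b)) w)) (case a of (u, v) \<Rightarrow> u @ v) = a"
    by (clarify; drule words_length; drule words_length; simp)
  show "(\<lambda>(u, v). u @ v) ` (words R b \<times> words R c) \<subseteq> (\<Union>d. words R (b @ d # c))"
    by (clarify, simp add: words_def steps_append)
  show "(\<lambda>w. (take (Suc (length b)) w, drop (Suc (length b)) w)) ` (\<Union>d. words R (b @ d # c))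
      \<subseteq> words R b \<times> words R c"
  proof (safe)
    fix w d assume w: "w \<in> words R (b @ d # c)"
    define u v where "u = take (Suc (length b)) w" and "v = drop (Suc (length b)) w"
    have len: "length w = Suc (Suc (length b + length c))"
      using words_length[OF w] by simp
    then have "u \<noteq> []" "v \<noteq> []" "length u = Suc (length b)"
      by (auto simp: u_def v_def)
    moreover have "w = u @ v" by (simp add: u_def v_def)
    ultimately have "steps R u @ R (last u) (hd v) # steps R v = b @ d # c"
      using w steps_append[of u v R] by (simp add: words_def)
    moreover have "length (steps R u) = length b"
      using \<open>length u = Suc (length b)\<close> by simp
    ultimately have "u \<in> words R b \<and> v \<in> words R c"
      using \<open>u \<noteq> []\<close> \<open>v \<noteq> []\<close> by (simp add: words_def)
    then show "take (Suc (length b)) w \<in> words R b" "drop (Suc (length b)) w \<in> words R c"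
      by (simp_all add: u_def v_def)
  qed
next
  show "\<forall>w\<in>\<Union>d. words R (b @ d # c).
      (case (take (Suc (length b)) w, drop (Suc (length b)) w) of (u, v) \<Rightarrow> u @ v) = w"
    by (intro ballI) (simp only: prod.case append_take_drop_id)
qed

lemma words_disjoint: "b \<noteq> c \<Longrightarrow> words R b \<inter> words R c = {}"
  by (auto simp: words_def)

section \<open>Ribbon functions\<close>

text \<open>
  A letter \<open>True\<close> of \<open>b\<close> is a descent of the word, so that the words counted here are the
  row readings, from the bottom left cell to the top right cell, of the tableaux on the ribbon
  whose steps go up at \<open>True\<close> and right at \<open>False\<close>.
\<close>

definition ribbon_fun :: "bool list \<Rightarrow> mpser" where
  "ribbon_fun b = enumerator (words (>) b) mset"

lemma finite_mset_fibre: "finite {w \<in> A. mset w = m}"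
proof (rule finite_subset)
  show "{w \<in> A. mset w = m} \<subseteq> {w. set w \<subseteq> set_mset m \<and> length w = size m}"
    by auto
qed (rule finite_lists_length_eq, simp)

lemma ribbon_fun_mult:
  "ribbon_fun b * ribbon_fun c = ribbon_fun (b @ True # c) + ribbon_fun (b @ False # c)"
proof -
  have "ribbon_fun b * ribbon_fun c
      = enumerator (words (>) b \<times> words (>) c) (\<lambda>(u, v). mset u + mset v)"
    unfolding ribbon_fun_def by (rule enumerator_Times) (rule finite_mset_fibre)+
  also have "\<dots> = enumerator (\<Union>d. words (>) (b @ d # c)) mset"
    by (rule enumerator_bij_betw[OF bij_betw_append_words]) (simp add: case_prod_unfold)
  also have "(\<Union>d. words (>) (b @ d # c)) = words (>) (b @ True # c) \<union> words (>) (b @ False # c)"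
    by (simp add: UNIV_bool Un_commute)
  also have "enumerator \<dots> mset = ribbon_fun (b @ True # c) + ribbon_fun (b @ False # c)"
    unfolding ribbon_fun_def
    by (rule enumerator_Un) (simp_all add: words_disjoint finite_mset_fibre)
  finally show ?thesis .
qed

text \<open>A weakly increasing word is determined by its multiset of letters, so each monomial of
  the right degree is counted once.\<close>

lemma ribbon_fun_hsym: "ribbon_fun (replicate k False) = hsym (Suc k)"
proof (rule mpser_eqI)
  fix m :: "nat multiset"
  have st: "steps (>) w = replicate k False \<longleftrightarrow> sorted w" if "length w = Suc k" for w :: "nat list"
    using that by (auto simp: list_eq_iff_nth_eq nth_steps sorted_iff_nth_Suc not_less)
  have "{w \<in> words (>) (replicate k False). mset w = m}
      = (if size m = Suc k then {sorted_list_of_multiset m} else {})"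
  proof -
    have "w \<in> words (>) (replicate k False) \<and> mset w = m \<longleftrightarrow>
        size m = Suc k \<and> w = sorted_list_of_multiset m" for w
    proof
      assume *: "w \<in> words (>) (replicate k False) \<and> mset w = m"
      then have "length w = Suc k" using words_length by fastforce
      with * st[of w] show "size m = Suc k \<and> w = sorted_list_of_multiset m"
        by (auto simp: words_def sorted_sort_id)
    next
      assume *: "size m = Suc k \<and> w = sorted_list_of_multiset m"
      then have "length w = Suc k" "mset w = m"
        by (metis mset_sorted_list_of_multiset size_mset)+
      with * st[of w] show "w \<in> words (>) (replicate k False) \<and> mset w = m"
        by (auto simp: words_def)
    qed
    then show ?thesis by auto
  qed
  then show "mcoeff (ribbon_fun (replicate k False)) m = mcoeff (hsym (Suc k)) m"
    by (simp add: ribbon_fun_def mcoeff_enumerator hsym_def)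
qed

lemma hsym_0: "hsym 0 = 1"
  by (rule mpser_eqI) (simp add: hsym_def mcoeff_one)

section \<open>The generating function of ribbons without double descents\<close>

text \<open>Two adjacent descents put three cells into one column, so this is the condition that all
  columns have size 1 or 2.\<close>

fun no_double_descent :: "bool list \<Rightarrow> bool" where
  "no_double_descent (x # y # b) \<longleftrightarrow> \<not> (x \<and> y) \<and> no_double_descent (y # b)"
| "no_double_descent _ \<longleftrightarrow> True"

definition hook_patterns :: "nat \<Rightarrow> bool list set" where
  "hook_patterns n = {b. Suc (length b) = n \<and> no_double_descent b}"

lemma finite_hook_patterns [simp]: "finite (hook_patterns n)"
proof (rule finite_subset)
  show "hook_patterns n \<subseteq> {b. set b \<subseteq> UNIV \<and> length b = n - 1}"
    by (auto simp: hook_patterns_def)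
qed (rule finite_lists_length_eq, simp)

lemma hook_patterns_1: "hook_patterns (Suc 0) = {[]}"
  by (auto simp: hook_patterns_def)

lemma hook_patterns_2: "hook_patterns (Suc (Suc 0)) = {[False], [True]}"
  by (auto simp: hook_patterns_def length_Suc_conv)

lemma no_double_descent_Cons_False [simp]: "no_double_descent (False # b) \<longleftrightarrow> no_double_descent b"
  by (cases b) auto

text \<open>This splits off the first column: one of size 1 contributes \<open>False\<close>, one of
  size 2 contributes \<open>True, False\<close>. The final \<open>False\<close> belongs to the step
  into the next column, which may be absent when there are only one or two cells; hence the separate
  small cases.\<close>

lemma hook_patterns_3:
  "hook_patterns (Suc (Suc (Suc n))) = (\<lambda>b. False # b) ` hook_patterns (Suc (Suc n)) \<union>
     (\<lambda>b. True # False # b) ` hook_patterns (Suc n)"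
proof (rule set_eqI)
  fix b
  show "b \<in> hook_patterns (Suc (Suc (Suc n))) \<longleftrightarrow>
      b \<in> (\<lambda>b. False # b) ` hook_patterns (Suc (Suc n)) \<union>
        (\<lambda>b. True # False # b) ` hook_patterns (Suc n)"
  proof (cases b)
    case (Cons x c)
    then show ?thesis
      by (cases c; cases x; cases "hd c") (auto simp: hook_patterns_def)
  qed (auto simp: hook_patterns_def)
qed

text \<open>For a pattern without double descents each descent is a column of size 2, marked by y;
  the remaining cells are columns of size 1, marked by x.\<close>

definition pattern_weight :: "'a::comm_ring_1 \<Rightarrow> 'a \<Rightarrow> bool list \<Rightarrow> 'a" where
  "pattern_weight x y b =
     y ^ count_list b True * x ^ (Suc (length b) - 2 * count_list b True)"

text \<open>Keeps the natural-number subtraction in the exponent of \<open>pattern_weight\<close>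
  exact.\<close>

lemma count_True_le: "no_double_descent b \<Longrightarrow> 2 * count_list b True \<le> Suc (length b)"
  by (induction b rule: induct_list012) (auto split: if_splits)

lemma pattern_weight_False:
  "no_double_descent b \<Longrightarrow> pattern_weight x y (False # b) = x * pattern_weight x y b"
  using count_True_le[of b] by (simp add: pattern_weight_def Suc_diff_le)

lemma pattern_weight_True_False: "pattern_weight x y (True # False # b) = y * pattern_weight x y b"
  by (simp add: pattern_weight_def)

section \<open>Telescoping along the size of the first column\<close>

lemma smult_sum_right: "smult c (sum f A) = (\<Sum>x\<in>A. smult c (f x))"
  by (induction A rule: infinite_finite_induct) (simp_all add: smult_add_right)

text \<open>The elementary symmetric function, as the ribbon consisting of one column of n cells. A
  pattern always describes at least one cell, so degree 0 is set separately, here and in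
  \<open>hook_poly\<close>.\<close>

definition esym :: "nat \<Rightarrow> mpser" where
  "esym n = (if n = 0 then 1 else ribbon_fun (replicate (n - 1) True))"

definition hook_poly :: "mpser poly \<Rightarrow> mpser poly \<Rightarrow> nat \<Rightarrow> mpser poly" where
  "hook_poly x y n = (if n = 0 then 1 else
     (\<Sum>b\<in>hook_patterns n. smult (ribbon_fun b) (pattern_weight x y b)))"

text \<open>Ribbons of n cells whose first column has exactly m cells, this column unweighted and
  the others weighted as in a skew hook. The values 0 for \<open>m = 0\<close> and
  \<open>n < m\<close> make the boundary terms of the telescoping sum vanish.\<close>

definition run_poly :: "mpser poly \<Rightarrow> mpser poly \<Rightarrow> nat \<Rightarrow> nat \<Rightarrow> mpser poly" where
  "run_poly x y n m = (if m = 0 \<or> n < m then 0 else if m = n then [:esym n:] else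
     (\<Sum>b\<in>hook_patterns (n - m).
        smult (ribbon_fun (replicate (m - 1) True @ False # b)) (pattern_weight x y b)))"

text \<open>Prefixing m descents enlarges the first column of the hook: of size 1 before, it gets m
  + 1 cells and leaves behind its weight x; of size 2 before, it gets m + 2 cells and leaves behind
  y.\<close>

lemma sum_hook_patterns_prefix:
  assumes "0 < l"
  shows "(\<Sum>b\<in>hook_patterns l. smult (ribbon_fun (replicate m True @ b)) (pattern_weight x y b)) =
    x * run_poly x y (m + l) (Suc m) + y * run_poly x y (m + l) (Suc (Suc m))"
proof -
  have repl: "replicate m True @ True # c = True # replicate m True @ c" for c
    by (induction m) auto
  consider "l = 1" | "l = 2" | k where "l = Suc (Suc (Suc k))"
    using assms by (metis One_nat_def Suc_1 gr0_implies_Suc not0_implies_Suc)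
  then show ?thesis
  proof cases
    case 1
    then show ?thesis
      by (simp add: hook_patterns_1 run_poly_def esym_def pattern_weight_def mult.commute)
  next
    case 2
    then show ?thesis
      by (simp add: hook_patterns_2 hook_patterns_1 run_poly_def esym_def pattern_weight_def numeral_2_eq_2
          repl algebra_simps)
  next
    case 3
    let ?A = "hook_patterns (Suc (Suc k))" and ?B = "hook_patterns (Suc k)"
    let ?f = "\<lambda>b. smult (ribbon_fun (replicate m True @ b)) (pattern_weight x y b)"
    have "sum ?f (hook_patterns l) = sum ?f ((\<lambda>b. False # b) ` ?A) +
        sum ?f ((\<lambda>b. True # False # b) ` ?B)"
      unfolding 3 hook_patterns_3 by (rule sum.union_disjoint) auto
    also have "sum ?f ((\<lambda>b. False # b) ` ?A) = x * run_poly x y (m + l) (Suc m)"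
      by (subst sum.reindex)
         (auto simp: 3 run_poly_def sum_distrib_left pattern_weight_False hook_patterns_def
           intro!: sum.cong)
    also have "sum ?f ((\<lambda>b. True # False # b) ` ?B) = y * run_poly x y (m + l) (Suc (Suc m))"
      by (subst sum.reindex)
         (auto simp: 3 run_poly_def sum_distrib_left pattern_weight_True_False inj_on_def repl
           intro!: sum.cong)
    finally show ?thesis .
  qed
qed

text \<open>A descent at the cut fuses the column of \<open>esym m\<close> with the first column of
  the hook, giving the terms with x and y; without a descent the first column keeps exactly m
  cells.\<close>

lemma smult_esym_hook_poly:
  assumes "m \<le> n" "0 < n"
  shows "smult (esym m) (hook_poly x y (n - m)) =
    run_poly x y n m + x * run_poly x y n (Suc m) + y * run_poly x y n (Suc (Suc m))"
proof -
  consider "m = n" | "m = 0" | k where "m = Suc k" "m < n"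
    using assms by (cases m) force+
  then show ?thesis
  proof cases
    case 1
    with assms show ?thesis by (simp add: hook_poly_def run_poly_def)
  next
    case 2
    then show ?thesis
      using assms sum_hook_patterns_prefix[of n 0 x y]
      by (simp add: hook_poly_def esym_def run_poly_def)
  next
    case 3
    have "smult (esym m) (hook_poly x y (n - m)) =
        (\<Sum>b\<in>hook_patterns (n - m). smult (ribbon_fun (replicate m True @ b)) (pattern_weight x y b)) +
        (\<Sum>b\<in>hook_patterns (n - m).
          smult (ribbon_fun (replicate k True @ False # b)) (pattern_weight x y b))"
      using 3 by (simp add: hook_poly_def esym_def smult_sum_right ribbon_fun_mult smult_add_left
          sum.distrib replicate_app_Cons_same)
    also have "\<dots> = x * run_poly x y n (Suc m) + y * run_poly x y n (Suc (Suc m)) + run_poly x y n m"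
      using 3 sum_hook_patterns_prefix[of "n - m" m x y] by (simp add: run_poly_def)
    finally show ?thesis by (simp add: algebra_simps)
  qed
qed

text \<open>The sequence c consists of the coefficients of 1/(1 + xz + yz^2), so for 1 \<le> j \<le>
  n the terms with \<open>R j\<close> have total factor c_j + x c_(j-1) + y c_(j-2) = 0 (with c_(-1)
  = 0). Only the terms beyond n survive.\<close>

lemma telescope:
  fixes c R :: "nat \<Rightarrow> 'a :: comm_ring_1"
  assumes "R 0 = 0" "c 0 = 1" "c 1 = - x" "\<And>m. c (Suc (Suc m)) = - x * c (Suc m) - y * c m"
  shows "(\<Sum>m\<le>n. c m * (R m + x * R (Suc m) + y * R (Suc (Suc m)))) =
    y * c n * R (Suc (Suc n)) - c (Suc n) * R (Suc n)"
proof (induction n)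
  case 0
  show ?case using assms by simp
next
  case (Suc n)
  show ?case
    unfolding sum.atMost_Suc Suc.IH assms(4)[of n] by (simp add: algebra_simps)
qed

lemma sum_esym_hook_poly:
  assumes "0 < n" "c 0 = 1" "c 1 = - x" "\<And>m. c (Suc (Suc m)) = - x * c (Suc m) - y * c m"
  shows "(\<Sum>m\<le>n. c m * [:esym m:] * hook_poly x y (n - m)) = 0"
proof -
  have "(\<Sum>m\<le>n. c m * [:esym m:] * hook_poly x y (n - m)) = 
      (\<Sum>m\<le>n. c m * (run_poly x y n m + x * run_poly x y n (Suc m) + y * run_poly x y n (Suc (Suc m))))"
    using assms(1) by (intro sum.cong refl) (simp add: mult.assoc flip: smult_esym_hook_poly)
  also have "\<dots> = 0"
    by (subst telescope[OF _ assms(2-4)]) (simp_all add: run_poly_def)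
  finally show ?thesis .
qed

text \<open>The same telescoping with x = 1 and y = 0, where \<open>R m\<close> is the hook with m
  cells in its column and n cells in all: a descent at the cut puts the first cell of the row on top
  of the column.\<close>

lemma sum_esym_hsym:
  assumes "0 < n"
  shows "(\<Sum>m\<le>n. (-1) ^ m * esym m * hsym (n - m)) = 0"
proof -
  define R where "R m = (if m = 0 then 0 else if n < m then 0
    else ribbon_fun (replicate (m - 1) True @ replicate (n - m) False))" for m
  have "esym m * hsym (n - m) = R m + R (Suc m)" if "m \<le> n" for m
  proof -
    consider "m = n" | "m = 0" | k where "m = Suc k" "m < n"
      using assms \<open>m \<le> n\<close> by (cases m) force+
    then show ?thesis
    proof cases
      case 1
      with assms show ?thesis by (simp add: R_def esym_def hsym_0)
    next
      case 2
      with assms show ?thesis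
        using ribbon_fun_hsym[of "n - 1"] by (simp add: R_def esym_def)
    next
      case 3
      then obtain l where "n - m = Suc l" by (metis Suc_diff_Suc)
      moreover from this have "n - Suc m = l" by simp
      ultimately show ?thesis
        using 3 by (auto simp: R_def esym_def ribbon_fun_mult replicate_app_Cons_same
            simp flip: ribbon_fun_hsym)
    qed
  qed
  then have "(\<Sum>m\<le>n. (-1) ^ m * esym m * hsym (n - m)) =
      (\<Sum>m\<le>n. (-1) ^ m * (R m + 1 * R (Suc m) + 0 * R (Suc (Suc m))))"
    by (intro sum.cong refl) (simp add: mult.assoc)
  also have "\<dots> = 0"
    by (subst telescope) (simp_all add: R_def)
  finally show ?thesis .
qed

section \<open>Comparison of the two generating functions\<close>

lemma fps_mult_dilate:
  fixes a b :: "nat \<Rightarrow> 'a :: comm_ring_1"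
  shows "Abs_fps (\<lambda>n. t ^ n * a n) * Abs_fps (\<lambda>n. t ^ n * b n) =
    Abs_fps (\<lambda>n. t ^ n * fps_nth (Abs_fps a * Abs_fps b) n)"
proof (rule fps_ext)
  fix n
  have "t ^ i * a i * (t ^ (n - i) * b (n - i)) = t ^ n * (a i * b (n - i))" if "i \<le> n" for i
  proof -
    have "t ^ n = t ^ i * t ^ (n - i)" using that by (simp flip: power_add)
    then show ?thesis by (simp add: mult_ac)
  qed
  then show "fps_nth (Abs_fps (\<lambda>n. t ^ n * a n) * Abs_fps (\<lambda>n. t ^ n * b n)) n =
      fps_nth (Abs_fps (\<lambda>n. t ^ n * fps_nth (Abs_fps a * Abs_fps b) n)) n"
    by (simp add: fps_mult_nth sum_distrib_left)
qed

text \<open>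
  The coefficients of \<open>(E(-z) - t E(-tz)) / (1 - t)\<close> satisfy the recurrence of
  \<open>sum_esym_hook_poly\<close>, since \<open>1/((1 + z)(1 + tz)) = \<Sum> c\<^sub>n z\<^sup>n\<close>.
\<close>

fun geometric_coeff :: "'a::comm_ring_1 \<Rightarrow> nat \<Rightarrow> 'a" where
  "geometric_coeff t 0 = 1"
| "geometric_coeff t (Suc 0) = - (1 + t)"
| "geometric_coeff t (Suc (Suc n)) = - (1 + t) * geometric_coeff t (Suc n) - t * geometric_coeff t n"

text \<open>The partial fraction expansion of 1/((1 + z)(1 + tz)), with the denominator 1 - t
  multiplied out.\<close>

lemma geometric_coeff: "(1 - t) * geometric_coeff t n = (-1) ^ n * (1 - t ^ Suc n)"
proof (induction n rule: induct_nat_012)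
  case (ge2 n)
  have "(1 - t) * geometric_coeff t (Suc (Suc n)) =
      - (1 + t) * ((1 - t) * geometric_coeff t (Suc n)) - t * ((1 - t) * geometric_coeff t n)"
    by (simp add: algebra_simps)
  also have "\<dots> = (-1) ^ Suc (Suc n) * (1 - t ^ Suc (Suc (Suc n)))"
    unfolding ge2 by (simp add: algebra_simps)
  finally show ?case .
qed (simp_all add: algebra_simps)

lemma const_poly_signed_sum:
  "(\<Sum>m\<le>n. ((-1) ^ m * [:f m:]) * [:g m:]) = [:\<Sum>m\<le>n. (-1) ^ m * f m * g m:]"
  for f g :: "nat \<Rightarrow> 'a :: comm_ring_1"
proof -
  have "(-1) ^ m * p = smult ((-1) ^ m) p" for m and p :: "'a poly"
    by (cases "even m") simp_all
  then have "((-1) ^ m * [:f m:]) * [:g m:] = [:(-1) ^ m * f m * g m:]" for m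
    by (simp add: mult_ac)
  then show ?thesis
    by (simp add: sum_to_poly)
qed

theorem Qtilde_eq_hook_poly: "Qtilde n = hook_poly (1 + tvar) tvar n"
proof -
  define t where "t = tvar"
  define H where "H = H_series"
  define Ht where "Ht = Abs_fps (\<lambda>n. t ^ n * [:hsym n:])"
  define e where "e m = (-1) ^ m * [:esym m:]" for m
  define E where "E = Abs_fps e"
  define Et where "Et = Abs_fps (\<lambda>m. t ^ m * e m)"
  define G where "G = Abs_fps (hook_poly (1 + t) t)"
  define C where "C = Abs_fps (\<lambda>m. geometric_coeff t m * [:esym m:])"
  define Q where "Q = Q_series"
  define T where "T = Abs_fps Qtilde"
  \<comment> \<open>The factor 1 - t has no inverse but is not a zero divisor, which suffices to
    drop it from each coefficient.\<close>
  have cancel: "p = 0" if "(1 - t) * p = 0" for p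
    using that one_minus_tvar_cancel by (simp add: t_def)
  have HE: "E * H = 1"
  proof (rule fps_ext)
    fix n
    show "fps_nth (E * H) n = fps_nth 1 n"
    proof (cases "n = 0")
      case True
      then show ?thesis
        by (simp add: E_def H_def H_series_def e_def esym_def hsym_0 one_pCons)
    next
      case False
      then show ?thesis
        using sum_esym_hsym[of n]
        by (simp only: E_def H_def H_series_def e_def fps_mult_nth fps_nth_Abs_fps
            const_poly_signed_sum atLeast0AtMost) simp
    qed
  qed
  \<comment> \<open>The substitution of tz for z is multiplicative, so \<open>HE\<close> carries
    over.\<close>
  have HEt: "Et * Ht = 1"
  proof -
    have "Et * Ht = Abs_fps (\<lambda>n. t ^ n * fps_nth (E * H) n)"
      unfolding Et_def Ht_def E_def H_def H_series_def by (rule fps_mult_dilate)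
    also have "\<dots> = 1"
      unfolding HE by (rule fps_ext) simp
    finally show ?thesis .
  qed
  have CG: "C * G = 1"
  proof (rule fps_ext)
    fix n
    show "fps_nth (C * G) n = fps_nth 1 n"
    proof (cases "n = 0")
      case True
      then show ?thesis
        by (simp add: C_def G_def hook_poly_def esym_def one_pCons)
    next
      case False
      then show ?thesis
        using sum_esym_hook_poly[of n "geometric_coeff t" "1 + t" t]
        by (simp add: C_def G_def fps_mult_nth atLeast0AtMost)
    qed
  qed
  have C: "fps_const (1 - t) * C = E - fps_const t * Et"
  proof (rule fps_ext)
    fix n
    have "(1 - t) * (geometric_coeff t n * [:esym n:]) = (-1) ^ n * (1 - t ^ Suc n) * [:esym n:]"
      by (simp only: geometric_coeff flip: mult.assoc)
    then show "fps_nth (fps_const (1 - t) * C) n = fps_nth (E - fps_const t * Et) n"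
      by (simp only: C_def E_def Et_def e_def fps_mult_left_const_nth fps_nth_Abs_fps fps_sub_nth)
         (simp add: algebra_simps)
  qed
  have Q: "Q * (Ht - fps_const t * H) = fps_const (1 - t) * H"
  proof -
    have "Ht = H_series oo (fps_const tvar * fps_X)"
      unfolding Ht_def t_def fps_compose_linear by (simp only: H_series_def fps_nth_Abs_fps)
    then show ?thesis
      using theI'[OF Q_series_ex1] unfolding Q_def Q_series_def H_def t_def by simp
  qed
  have Q0: "fps_nth Q 0 = 1"
  proof -
    have "fps_nth (Q * (Ht - fps_const t * H)) 0 = fps_nth (fps_const (1 - t) * H) 0"
      by (simp only: Q)
    then have "(1 - t) * (fps_nth Q 0 - 1) = 0"
      by (simp add: Ht_def H_def H_series_def hsym_0 one_pCons[symmetric] algebra_simps)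
    then show ?thesis using cancel by fastforce
  qed
  \<comment> \<open>The sum in \<open>Qtilde\<close> starts at m = 1; subtracting 1 from Q removes
    precisely its constant term \<open>Q0\<close>.\<close>
  have TQ: "T = H + fps_const t * (H * (Q - 1))"
  proof (rule fps_ext)
    fix n
    have "fps_nth (H * (Q - 1)) n = fps_nth ((Q - 1) * H) n"
      by (simp only: mult.commute)
    also have "\<dots> = (\<Sum>m=0..n. fps_nth (Q - 1) m * [:hsym (n - m):])"
      by (simp add: fps_mult_nth H_def H_series_def)
    also have "\<dots> = (\<Sum>m=1..n. fps_nth (Q - 1) m * [:hsym (n - m):])"
      by (rule sum.mono_neutral_right) (auto simp: Q0 not_less_eq_eq)
    also have "\<dots> = (\<Sum>m=1..n. [:hsym (n - m):] * Qpoly m)"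
      by (rule sum.cong) (auto simp: Q_def Qpoly_def mult.commute)
    finally show "fps_nth T n = fps_nth (H + fps_const t * (H * (Q - 1))) n"
      by (simp only: T_def Qtilde_def H_def H_series_def t_def fps_nth_Abs_fps fps_add_nth
          fps_mult_left_const_nth)
  qed
  have "T * (Ht - fps_const t * H) = H * (Ht - fps_const t * H)
      + fps_const t * H * (Q * (Ht - fps_const t * H)) - fps_const t * H * (Ht - fps_const t * H)"
    unfolding TQ by (simp only: algebra_simps mult_1_left mult_1_right)
  \<comment> \<open>The defining equation of Q replaces the middle term, and (1 - t) H (Ht - t H) +
    t (1 - t) H^2 = (1 - t) H Ht.\<close>
  also have "\<dots> = fps_const (1 - t) * H * Ht"
    unfolding Q by (simp add: algebra_simps flip: fps_const_sub)
  finally have T: "T * (Ht - fps_const t * H) = fps_const (1 - t) * H * Ht" .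
  \<comment> \<open>Multiplying by E(-z) E(-tz) clears H(z) and H(tz) from the denominator of Q and
    leaves E(-z) - t E(-tz), the multiple of C found above.\<close>
  have "(Ht - fps_const t * H) * (E * Et) = fps_const (1 - t) * C"
  proof -
    have "(Ht - fps_const t * H) * (E * Et) = (Et * Ht) * E - fps_const t * ((E * H) * Et)"
      by (simp add: algebra_simps)
    then show ?thesis by (simp add: HE HEt C)
  qed
  then have "T * (fps_const (1 - t) * C) = T * (Ht - fps_const t * H) * (E * Et)"
    by (simp add: mult.assoc)
  also have "\<dots> = fps_const (1 - t) * (E * H) * (Et * Ht)"
    unfolding T by (simp only: mult_ac)
  finally have "T * (fps_const (1 - t) * C) * G = fps_const (1 - t) * G"
    by (simp add: HE HEt)
  then have "fps_const (1 - t) * T * (C * G) = fps_const (1 - t) * G"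
    by (simp only: mult_ac)
  then have "fps_const (1 - t) * (T - G) = 0"
    by (simp add: CG right_diff_distrib)
  then have "(1 - t) * fps_nth (T - G) n = 0"
    by (metis fps_mult_left_const_nth fps_zero_nth)
  then have "fps_nth T n = fps_nth G n"
    using cancel by (metis eq_iff_diff_eq_0 fps_sub_nth)
  then show ?thesis by (simp add: T_def G_def t_def)
qed

section \<open>Ribbons as diagrams\<close>

text \<open>The reading starts at the bottom left and row indices grow downwards, so the row counts
  the descents still to come and the column the non-descents already made. The last cell lies in row
  0 and the first in column 0, hence the ribbon is normalized.\<close>

definition ribbon_cell :: "bool list \<Rightarrow> nat \<Rightarrow> nat \<times> nat" where
  "ribbon_cell b p = (count_list (drop p b) True, count_list (take p b) False)"

definition ribbon :: "bool list \<Rightarrow> diagram" where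
  "ribbon b = ribbon_cell b ` {..length b}"

lemma ribbon_cell_0: "ribbon_cell b 0 = (count_list b True, 0)"
  by (simp add: ribbon_cell_def)

lemma ribbon_cell_True:
  assumes "p < length b" "b ! p"
  shows "fst (ribbon_cell b p) = Suc (fst (ribbon_cell b (Suc p)))"
    and "snd (ribbon_cell b p) = snd (ribbon_cell b (Suc p))"
proof -
  have "count_list (drop p b) True = count_list (b ! p # drop (Suc p) b) True"
    using Cons_nth_drop_Suc[OF assms(1)] by (rule arg_cong[OF sym])
  then show "fst (ribbon_cell b p) = Suc (fst (ribbon_cell b (Suc p)))"
    using assms(2) by (simp only: ribbon_cell_def fst_conv) simp
  show "snd (ribbon_cell b p) = snd (ribbon_cell b (Suc p))"
    using assms by (simp add: ribbon_cell_def take_Suc_conv_app_nth)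
qed

lemma ribbon_cell_False:
  assumes "p < length b" "\<not> b ! p"
  shows "fst (ribbon_cell b p) = fst (ribbon_cell b (Suc p))"
    and "Suc (snd (ribbon_cell b p)) = snd (ribbon_cell b (Suc p))"
proof -
  have "count_list (drop p b) True = count_list (b ! p # drop (Suc p) b) True"
    using Cons_nth_drop_Suc[OF assms(1)] by (rule arg_cong[OF sym])
  then show "fst (ribbon_cell b p) = fst (ribbon_cell b (Suc p))"
    using assms(2) by (simp only: ribbon_cell_def fst_conv) simp
  show "Suc (snd (ribbon_cell b p)) = snd (ribbon_cell b (Suc p))"
    using assms by (simp add: ribbon_cell_def take_Suc_conv_app_nth)
qed

text \<open>Each step, up or right, raises column minus row by one. A cell thus determines its
  position in the reading, which gives injectivity and later the inverse \<open>ix\<close>.\<close>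

lemma ribbon_cell_diagonal:
  "p \<le> length b \<Longrightarrow> snd (ribbon_cell b p) + count_list b True = p + fst (ribbon_cell b p)"
proof (induction p)
  case (Suc p)
  then show ?case
    using ribbon_cell_True[of p b] ribbon_cell_False[of p b] by (cases "b ! p") auto
qed (simp add: ribbon_cell_0)

lemma inj_on_ribbon_cell: "inj_on (ribbon_cell b) {..length b}"
proof (rule inj_onI)
  fix p q assume "p \<in> {..length b}" "q \<in> {..length b}" and eq: "ribbon_cell b p = ribbon_cell b q"
  then have "p + fst (ribbon_cell b q) = q + fst (ribbon_cell b q)"
    using ribbon_cell_diagonal[of p b] ribbon_cell_diagonal[of q b] unfolding eq by simp
  then show "p = q" by simp
qed

lemma finite_ribbon [simp]: "finite (ribbon b)"
  by (simp add: ribbon_def)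

lemma card_ribbon: "card (ribbon b) = Suc (length b)"
  by (simp add: ribbon_def card_image inj_on_ribbon_cell)

lemma ribbon_simps:
  "ribbon [] = {(0, 0)}"
  "ribbon (False # b) = insert (count_list b True, 0) ((\<lambda>(i, j). (i, Suc j)) ` ribbon b)"
  "ribbon (True # b) = insert (Suc (count_list b True), 0) (ribbon b)"
proof -
  show "ribbon [] = {(0, 0)}"
    by (simp add: ribbon_def ribbon_cell_def)
  have eq: "ribbon (x # b) = insert (ribbon_cell (x # b) 0) ((\<lambda>p. ribbon_cell (x # b) (Suc p)) ` {..length b})" for x
    by (simp add: ribbon_def atMost_Suc_eq_insert_0 image_image)
  show "ribbon (False # b) = insert (count_list b True, 0) ((\<lambda>(i, j). (i, Suc j)) ` ribbon b)"
    unfolding eq by (simp add: ribbon_cell_def ribbon_def image_image)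
  show "ribbon (True # b) = insert (Suc (count_list b True), 0) (ribbon b)"
    unfolding eq by (simp add: ribbon_cell_def ribbon_def)
qed

lemma corner_in_ribbon: "(count_list b True, 0) \<in> ribbon b"
  unfolding ribbon_def by (rule image_eqI[of _ _ 0]) (simp_all add: ribbon_cell_0)

lemma ribbon_row_le: "(i, j) \<in> ribbon b \<Longrightarrow> i \<le> count_list b True"
proof -
  have "count_list (drop p b) True \<le> count_list b True" for p
    using count_list_append[of "take p b" "drop p b" True] by simp
  then show "(i, j) \<in> ribbon b \<Longrightarrow> i \<le> count_list b True"
    by (auto simp: ribbon_def ribbon_cell_def)
qed

text \<open>The number of descents is the largest row index. Once it is known, the diagonal of a
  cell gives its position in either reading, and the letters are read off from the changes of
  row.\<close>

lemma ribbon_inject: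
  assumes "ribbon b = ribbon c"
  shows "b = c"
proof -
  have len: "length b = length c"
    using arg_cong[OF assms, of card] by (simp add: card_ribbon)
  have cnt: "count_list b True = count_list c True"
    using corner_in_ribbon[of b] corner_in_ribbon[of c] ribbon_row_le assms by (metis antisym)
  have cell: "ribbon_cell b p = ribbon_cell c p" if "p \<le> length b" for p
  proof -
    have "ribbon_cell b p \<in> ribbon c"
      using that unfolding assms[symmetric] by (simp add: ribbon_def)
    then obtain q where "q \<le> length c" "ribbon_cell b p = ribbon_cell c q"
      by (auto simp: ribbon_def)
    then show ?thesis
      using ribbon_cell_diagonal[of p b] ribbon_cell_diagonal[of q c] that cnt by simp
  qed
  have "b ! p \<longleftrightarrow> fst (ribbon_cell b p) \<noteq> fst (ribbon_cell b (Suc p))" if "p < length b" for b p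
    using ribbon_cell_True[OF that] ribbon_cell_False[OF that] by auto
  then show ?thesis
    using len cell by (intro nth_equalityI) auto
qed

text \<open>
  A skew hook is the region between two partitions such that consecutive rows overlap in exactly
  one column; the last nonempty row is row \<open>r\<close>.
\<close>

definition hook_shape :: "nat \<Rightarrow> (nat \<Rightarrow> nat) \<Rightarrow> (nat \<Rightarrow> nat) \<Rightarrow> bool" where
  "hook_shape r l \<mu> \<longleftrightarrow> (\<forall>i>r. l i = 0) \<and> (\<forall>i\<ge>r. \<mu> i = 0) \<and> (\<forall>i\<le>r. \<mu> i < l i) \<and>
     (\<forall>i<r. l (Suc i) = Suc (\<mu> i))"

lemma hook_shape_le: "hook_shape r l \<mu> \<Longrightarrow> \<mu> i \<le> l i"
  by (cases "i \<le> r") (auto simp: hook_shape_def intro: less_imp_le)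

lemma hook_shape_partition:
  assumes "hook_shape r l \<mu>"
  shows "is_partition l" "is_partition \<mu>"
proof -
  have "l (Suc i) \<le> l i" for i
  proof (cases "i < r")
    case True
    then have "\<mu> i < l i" "l (Suc i) = Suc (\<mu> i)" using assms by (auto simp: hook_shape_def)
    then show ?thesis by simp
  qed (use assms in \<open>auto simp: hook_shape_def\<close>)
  moreover have "finite {i. l i \<noteq> 0}"
  proof (rule finite_subset)
    show "{i. l i \<noteq> 0} \<subseteq> {..r}"
      using assms by (auto simp: hook_shape_def intro: ccontr)
  qed simp
  ultimately show "is_partition l"
    by (simp add: is_partition_def antimono_iff_le_Suc)
  have "\<mu> (Suc i) \<le> \<mu> i" for i
  proof (cases "i < r")
    case True
    then have "\<mu> (Suc i) < l (Suc i)" "l (Suc i) = Suc (\<mu> i)"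
      using assms by (metis Suc_leI hook_shape_def)+
    then show ?thesis by simp
  qed (use assms in \<open>auto simp: hook_shape_def\<close>)
  moreover have "finite {i. \<mu> i \<noteq> 0}"
  proof (rule finite_subset)
    show "{i. \<mu> i \<noteq> 0} \<subseteq> {..<r}"
      using assms by (auto simp: hook_shape_def intro: ccontr)
  qed simp
  ultimately show "is_partition \<mu>"
    by (simp add: is_partition_def antimono_iff_le_Suc)
qed

lemma skew_cells_add_column:
  assumes "\<And>i. i < r \<Longrightarrow> l' i = Suc (l i) \<and> \<mu>' i = Suc (\<mu> i)" "l' r = Suc (l r)" "\<mu>' r = 0" "\<mu> r = 0"
    "\<And>i. i > r \<Longrightarrow> l i = 0 \<and> l' i = 0"
  shows "skew_cells l' \<mu>' = insert (r, 0) ((\<lambda>(i, j). (i, Suc j)) ` skew_cells l \<mu>)"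
proof (rule set_eqI)
  fix c :: "nat \<times> nat"
  obtain i j where c: "c = (i, j)" by (cases c)
  have "c \<in> (\<lambda>(i, j). (i, Suc j)) ` skew_cells l \<mu> \<longleftrightarrow> 0 < j \<and> (i, j - 1) \<in> skew_cells l \<mu>"
    by (auto simp: c gr0_conv_Suc intro: rev_image_eqI)
  moreover consider "i < r" | "i = r" | "i > r" by linarith
  then have "c \<in> skew_cells l' \<mu>' \<longleftrightarrow> c = (r, 0) \<or> 0 < j \<and> (i, j - 1) \<in> skew_cells l \<mu>"
    by cases (use assms in \<open>auto simp: c skew_cells_def\<close>)
  ultimately show "c \<in> skew_cells l' \<mu>' \<longleftrightarrow>
      c \<in> insert (r, 0) ((\<lambda>(i, j). (i, Suc j)) ` skew_cells l \<mu>)"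
    by simp
qed

lemma skew_cells_add_row:
  assumes "l r = 0" "\<mu> r = 0"
  shows "skew_cells (l(r := 1)) \<mu> = insert (r, 0) (skew_cells l \<mu>)"
  using assms by (auto simp: skew_cells_def split: if_splits)

lemma ribbon_hook_shape: "\<exists>l \<mu>. hook_shape (count_list b True) l \<mu> \<and> ribbon b = skew_cells l \<mu>"
proof (induction b)
  case Nil
  have "hook_shape 0 (\<lambda>i. if i = 0 then 1 else 0) (\<lambda>_. 0)"
    by (simp add: hook_shape_def)
  moreover have "ribbon [] = skew_cells (\<lambda>i. if i = 0 then 1 else 0) (\<lambda>_. 0)"
    by (auto simp: ribbon_simps skew_cells_def split: if_splits)
  ultimately show ?case by auto
next
  case (Cons x b)
  define r where "r = count_list b True"
  from Cons obtain l \<mu> where h: "hook_shape r l \<mu>" and D: "ribbon b = skew_cells l \<mu>"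
    by (auto simp: r_def)
  show ?case
  proof (cases x)
    case True
    have "hook_shape (Suc r) (l(Suc r := 1)) \<mu>"
      using h by (auto simp: hook_shape_def le_Suc_eq less_Suc_eq)
    moreover have "ribbon (x # b) = skew_cells (l(Suc r := 1)) \<mu>"
      using h True D by (subst skew_cells_add_row) (auto simp: hook_shape_def ribbon_simps r_def)
    ultimately show ?thesis using True by (auto simp: r_def)
  next
    case False
    let ?l = "\<lambda>i. if i \<le> r then Suc (l i) else 0" and ?\<mu> = "\<lambda>i. if i < r then Suc (\<mu> i) else 0"
    have "hook_shape r ?l ?\<mu>"
      using h by (auto simp: hook_shape_def)
    moreover have "ribbon (x # b) = skew_cells ?l ?\<mu>"
      using h False D by (subst skew_cells_add_column[of r _ l _ \<mu>]) (auto simp: hook_shape_def ribbon_simps r_def)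
    ultimately show ?thesis using False by (auto simp: r_def)
  qed
qed

text \<open>The induction removes the bottom left cell. If it fills the last row, this row
  disappears and the letter is \<open>True\<close>; otherwise the cell is alone in the first column,
  the rest moves one column to the left and the letter is \<open>False\<close>.\<close>

lemma hook_shape_ribbon:
  "hook_shape r l \<mu> \<Longrightarrow> \<exists>b. count_list b True = r \<and> skew_cells l \<mu> = ribbon b"
proof (induction "r + l 0" arbitrary: r l \<mu> rule: less_induct)
  case less
  note h = less.prems
  have pos: "0 < l r" using h by (auto simp: hook_shape_def)
  show ?case
  proof (cases "l r = 1")
    case True
    show ?thesis
    proof (cases r)
      case 0
      have "skew_cells l \<mu> = ribbon []"
      proof -
        have "l i = (if i = 0 then 1 else 0)" "\<mu> i = 0" for i
          using h True by (auto simp: 0 hook_shape_def)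
        then show ?thesis by (auto simp: ribbon_simps skew_cells_def split: if_splits)
      qed
      then show ?thesis using 0 by (intro exI[of _ "[]"]) simp
    next
      case (Suc q)
      have "hook_shape q (l(r := 0)) \<mu>"
        unfolding hook_shape_def
      proof (intro conjI allI impI)
        have "\<mu> q = 0" using h True by (auto simp: hook_shape_def Suc)
        then show "\<mu> i = 0" if "i \<ge> q" for i
          using h that by (cases "i = q") (auto simp: hook_shape_def Suc)
      qed (use h in \<open>auto simp: hook_shape_def Suc\<close>)
      then obtain b where b: "count_list b True = q" "skew_cells (l(r := 0)) \<mu> = ribbon b"
        using less.hyps[of q "l(r := 0)" \<mu>] by (auto simp: Suc)
      have "l = (l(r := 0))(r := 1)" using True by auto
      then have "skew_cells l \<mu> = insert (r, 0) (skew_cells (l(r := 0)) \<mu>)"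
        using skew_cells_add_row[of "l(r := 0)" r \<mu>] h by (auto simp: hook_shape_def)
      then have "skew_cells l \<mu> = ribbon (True # b)"
        by (simp only: b ribbon_simps) (simp add: Suc)
      then show ?thesis using b by (intro exI[of _ "True # b"]) (simp add: Suc)
    qed
  next
    case False
    have l2: "2 \<le> l i" if "i \<le> r" for i
    proof -
      have "l r \<le> l i"
        using hook_shape_partition[OF h] that by (auto simp: is_partition_def antimono_def)
      then show ?thesis using False pos by simp
    qed
    have \<mu>1: "1 \<le> \<mu> i" if "i < r" for i
    proof -
      have "l (Suc i) = Suc (\<mu> i)" using h that by (auto simp: hook_shape_def)
      then show ?thesis using l2[of "Suc i"] that by simp
    qed
    let ?l = "\<lambda>i. l i - 1" and ?\<mu> = "\<lambda>i. \<mu> i - 1"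
    have "hook_shape r ?l ?\<mu>"
      unfolding hook_shape_def
    proof (intro conjI allI impI)
      fix i assume "i \<le> r"
      then show "\<mu> i - 1 < l i - 1"
        using h l2[of i] \<mu>1[of i] by (cases "i = r") (auto simp: hook_shape_def diff_less_mono)
    next
      fix i assume "i < r"
      then show "l (Suc i) - 1 = Suc (\<mu> i - 1)"
        using h \<mu>1[of i] by (auto simp: hook_shape_def)
    qed (use h in \<open>auto simp: hook_shape_def\<close>)
    moreover have "r + ?l 0 < r + l 0" using l2[of 0] by simp
    ultimately obtain b where b: "count_list b True = r" "skew_cells ?l ?\<mu> = ribbon b"
      using less.hyps[of r ?l ?\<mu>] by auto
    have "skew_cells l \<mu> = insert (r, 0) ((\<lambda>(i, j). (i, Suc j)) ` skew_cells ?l ?\<mu>)"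
    proof (rule skew_cells_add_column)
      show "l i = Suc (l i - 1) \<and> \<mu> i = Suc (\<mu> i - 1)" if "i < r" for i
        using l2[of i] \<mu>1[of i] that by simp
    qed (use h pos in \<open>auto simp: hook_shape_def\<close>)
    then have "skew_cells l \<mu> = ribbon (False # b)"
      by (simp only: b ribbon_simps)
    then show ?thesis using b by (intro exI[of _ "False # b"]) simp
  qed
qed

lemma connected_diagram_ribbon:
  "connected_diagram (ribbon b)"
proof -
  let ?R = "{(x, y). x \<in> ribbon b \<and> y \<in> ribbon b \<and> adjacent_cells x y}"
  have step: "(ribbon_cell b p, ribbon_cell b (Suc p)) \<in> ?R" if "p < length b" for p
  proof -
    have "adjacent_cells (ribbon_cell b p) (ribbon_cell b (Suc p))"
      using ribbon_cell_True[OF that] ribbon_cell_False[OF that]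
      unfolding adjacent_cells_def by metis
    then show ?thesis using that by (simp add: ribbon_def)
  qed
  have path: "(ribbon_cell b 0, ribbon_cell b p) \<in> ?R\<^sup>*" if "p \<le> length b" for p
    using that
  proof (induction p)
    case (Suc p)
    then show ?case using step[of p] by (meson Suc_leD Suc_le_lessD rtrancl.rtrancl_into_rtrancl)
  qed simp
  have "sym ?R"
    by (auto simp: sym_def adjacent_cells_def)
  then have "sym (?R\<^sup>*)" by (rule sym_rtrancl)
  then have "(ribbon_cell b p, ribbon_cell b q) \<in> ?R\<^sup>*" if "p \<le> length b" "q \<le> length b" for p q
    using path[OF that(1)] path[OF that(2)] by (meson rtrancl_trans symD)
  then show ?thesis
    unfolding connected_diagram_def by (auto simp: ribbon_def)
qed

lemma skew_hook_ribbon: "skew_hook (ribbon b)"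
proof -
  obtain l \<mu> where h: "hook_shape (count_list b True) l \<mu>" and D: "ribbon b = skew_cells l \<mu>"
    using ribbon_hook_shape by blast
  have "skew_diagram (ribbon b)"
    unfolding skew_diagram_def using hook_shape_partition[OF h] hook_shape_le[OF h] D by blast
  moreover have "False" if sq: "{(i, j), (i, Suc j), (Suc i, j), (Suc i, Suc j)} \<subseteq> ribbon b" for i j
  proof -
    from sq have "\<mu> i \<le> j" "Suc j < l (Suc i)" by (auto simp: D skew_cells_def)
    moreover from this have "i < count_list b True"
      using h by (metis Suc_leI hook_shape_def leI le_imp_less_Suc not_less_zero)
    then have "l (Suc i) = Suc (\<mu> i)"
      using h by (auto simp: hook_shape_def)
    ultimately show False by simp
  qed
  moreover have "ribbon b \<noteq> {}" using corner_in_ribbon by blast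
  ultimately show ?thesis
    unfolding skew_hook_def using connected_diagram_ribbon by blast
qed

lemma normalized_ribbon: "normalized (ribbon b)"
proof -
  have "ribbon_cell b (length b) \<in> ribbon b" by (simp add: ribbon_def)
  then have "(0, snd (ribbon_cell b (length b))) \<in> ribbon b" by (simp add: ribbon_cell_def)
  then show ?thesis
    unfolding normalized_def using corner_in_ribbon[of b] by blast
qed

text \<open>Connectedness makes consecutive rows share a column, and the absence of a 2 x 2 square
  allows only one shared column. Normalization makes row 0 the first row and column 0 the first
  column.\<close>

lemma skew_hook_eq_ribbon:
  assumes "skew_hook D" "normalized D"
  obtains b where "D = ribbon b"
proof -
  from assms obtain l \<mu> where l: "is_partition l" "is_partition \<mu>" and le: "\<And>i. \<mu> i \<le> l i"
    and D: "D = skew_cells l \<mu>"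
    by (auto simp: skew_hook_def skew_diagram_def)
  have anti: "l j \<le> l i" "\<mu> j \<le> \<mu> i" if "i \<le> j" for i j
    using l that by (auto simp: is_partition_def antimono_def)
  have "D \<subseteq> (SIGMA i:{i. l i \<noteq> 0}. {..<l i})"
    by (auto simp: D skew_cells_def)
  with l have fin: "finite D"
    by (intro finite_subset[OF _ finite_SigmaI]) (auto simp: is_partition_def)
  define r where "r = Max (fst ` D)"
  have ne: "fst ` D \<noteq> {}" using assms by (auto simp: skew_hook_def)
  have "r \<in> fst ` D" unfolding r_def using fin ne by (intro Max_in) auto
  then obtain jr where jr: "(r, jr) \<in> D" by force
  have r_max: "i \<le> r" if "(i, j) \<in> D" for i j
    unfolding r_def using fin that by (intro Max_ge) force+
  obtain j0 i0 where z: "(0, j0) \<in> D" "(i0, 0) \<in> D"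
    using assms by (auto simp: normalized_def)
  have \<mu>r: "\<mu> r = 0"
    using anti(2)[of i0 r] r_max[OF z(2)] z(2) by (auto simp: D skew_cells_def)
  let ?R = "{(x, y). x \<in> D \<and> y \<in> D \<and> adjacent_cells x y}"
  \<comment> \<open>A path from row 0 to row r has to step from row i to the next one, and a step
    between rows stays in its column.\<close>
  have overlap: "\<exists>j. (i, j) \<in> D \<and> (Suc i, j) \<in> D" if "i < r" for i
  proof (rule ccontr)
    assume no: "\<not> ?thesis"
    have "((0, j0), (r, jr)) \<in> ?R\<^sup>*"
      using assms z jr unfolding skew_hook_def connected_diagram_def by blast
    then have "fst (r, jr) \<le> i"
    proof (induction rule: rtrancl_induct)
      case (step y w)
      obtain a c a' c' where yw: "y = (a, c)" "w = (a', c')" by fastforce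
      show ?case
      proof (rule ccontr)
        assume "\<not> fst w \<le> i"
        with step yw have "a = i" "a' = Suc i" "c = c'" by (auto simp: adjacent_cells_def)
        with step yw no show False by auto
      qed
    qed simp
    with that show False by simp
  qed
  have next_row: "l (Suc i) = Suc (\<mu> i)" if "i < r" for i
  proof (rule antisym)
    from overlap[OF that] show "Suc (\<mu> i) \<le> l (Suc i)"
      by (auto simp: D skew_cells_def)
    show "l (Suc i) \<le> Suc (\<mu> i)"
    proof (rule ccontr)
      assume "\<not> ?thesis"
      then have "{(i, \<mu> i), (i, Suc (\<mu> i)), (Suc i, \<mu> i), (Suc i, Suc (\<mu> i))} \<subseteq> D"
        using anti[of i "Suc i"] by (auto simp: D skew_cells_def)
      then show False using assms unfolding skew_hook_def by blast
    qed
  qed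
  have row: "\<mu> i < l i" if "i \<le> r" for i
  proof (cases "i = r")
    case True
    then show ?thesis using jr by (auto simp: D skew_cells_def)
  next
    case False
    then show ?thesis using overlap[of i] that by (auto simp: D skew_cells_def)
  qed
  have "hook_shape r (\<lambda>i. if i \<le> r then l i else 0) (\<lambda>i. if i \<le> r then \<mu> i else 0)"
    using next_row row \<mu>r by (auto simp: hook_shape_def)
  moreover have "D = skew_cells (\<lambda>i. if i \<le> r then l i else 0) (\<lambda>i. if i \<le> r then \<mu> i else 0)"
    using r_max by (auto simp: D skew_cells_def split: if_splits)
  ultimately show ?thesis using hook_shape_ribbon that by metis
qed

section \<open>Column sizes of a ribbon\<close>

fun column_sizes :: "bool list \<Rightarrow> nat list" where
  "column_sizes [] = [1]"
| "column_sizes (False # b) = 1 # column_sizes b"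
| "column_sizes (True # b) = Suc (hd (column_sizes b)) # tl (column_sizes b)"

lemma column_sizes_nonempty [simp]: "column_sizes b \<noteq> []"
  by (induction b rule: column_sizes.induct) auto

lemma column_sizes_pos: "c \<in> set (column_sizes b) \<Longrightarrow> 0 < c"
  by (induction b rule: column_sizes.induct) (auto dest: list.set_sel(2)[rotated])

lemma card_column_ribbon:
  "card (column (ribbon b) j) = (if j < length (column_sizes b) then column_sizes b ! j else 0)"
proof (induction b arbitrary: j rule: column_sizes.induct)
  case 1
  show ?case by (auto simp: ribbon_simps column_def)
next
  case (2 b)
  show ?case
  proof (cases j)
    case 0
    then have "column (ribbon (False # b)) j = {count_list b True}"
      by (auto simp: ribbon_simps column_def)
    then show ?thesis using 0 by simp
  next
    case (Suc k)
    then have "column (ribbon (False # b)) j = column (ribbon b) k"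
      by (auto simp: ribbon_simps column_def intro: rev_image_eqI)
    then show ?thesis using 2[of k] Suc by simp
  qed
next
  case (3 b)
  obtain c cs where cs: "column_sizes b = c # cs" by (cases "column_sizes b") auto
  have fin: "finite (column (ribbon b) j)"
    by (rule finite_subset[of _ "fst ` ribbon b"]) (force simp: column_def)+
  show ?case
  proof (cases j)
    case 0
    then have "column (ribbon (True # b)) j = insert (Suc (count_list b True)) (column (ribbon b) j)"
      by (auto simp: ribbon_simps column_def)
    moreover have "Suc (count_list b True) \<notin> column (ribbon b) j"
      using ribbon_row_le[of "Suc (count_list b True)" j b] by (auto simp: column_def)
    ultimately show ?thesis using 3[of j] 0 cs fin by simp
  next
    case (Suc k)
    then have "column (ribbon (True # b)) j = column (ribbon b) j"
      by (auto simp: ribbon_simps column_def)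
    then show ?thesis using 3[of j] Suc cs by simp
  qed
qed

lemma hd_column_sizes: "hd (column_sizes b) = 1 \<longleftrightarrow> b = [] \<or> \<not> hd b"
  using column_sizes_pos[of "hd (column_sizes (tl b))" "tl b"]
  by (cases b rule: column_sizes.cases) auto

lemma column_sizes_no_double: "set (column_sizes b) \<subseteq> {1, 2} \<longleftrightarrow> no_double_descent b"
proof (induction b rule: column_sizes.induct)
  case (3 b)
  obtain c cs where cs: "column_sizes b = c # cs" by (cases "column_sizes b") auto
  have "set (column_sizes (True # b)) \<subseteq> {1, 2} \<longleftrightarrow> c = 1 \<and> set (column_sizes b) \<subseteq> {1, 2}"
    using column_sizes_pos[of c b] cs by auto
  also have "\<dots> \<longleftrightarrow> (b = [] \<or> \<not> hd b) \<and> no_double_descent b"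
    using 3 hd_column_sizes[of b] cs by simp
  also have "\<dots> \<longleftrightarrow> no_double_descent (True # b)"
    by (cases b) auto
  finally show ?case .
qed auto

lemma count_column_sizes:
  "no_double_descent b \<Longrightarrow> count_list (column_sizes b) 2 = count_list b True \<and>
    count_list (column_sizes b) 1 + 2 * count_list b True = Suc (length b)"
proof (induction b rule: column_sizes.induct)
  case (3 b)
  obtain c cs where cs: "column_sizes b = c # cs" by (cases "column_sizes b") auto
  have "no_double_descent b" "b = [] \<or> \<not> hd b" using "3.prems" by (cases b; auto)+
  then have "c = 1" using hd_column_sizes[of b] cs by simp
  with "3.IH" \<open>no_double_descent b\<close> cs show ?case by simp
qed auto

lemma card_nth_eq: "card {j. j < length xs \<and> xs ! j = x} = count_list xs x"
  by (simp add: count_list_eq_length_filter length_filter_conv_card eq_commute)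

lemma ribbon_in_skew_hooks:
  assumes "0 < n"
  shows "ribbon b \<in> skew_hooks n k \<longleftrightarrow> b \<in> hook_patterns n \<and> count_list b True = k"
proof -
  have fin: "finite (column (ribbon b) j)" for j
    by (rule finite_subset[of _ "fst ` ribbon b"]) (force simp: column_def)+
  have ne: "column (ribbon b) j \<noteq> {} \<longleftrightarrow> j < length (column_sizes b)" for j
  proof -
    have "column (ribbon b) j \<noteq> {} \<longleftrightarrow> card (column (ribbon b) j) \<noteq> 0"
      using fin by simp
    then show ?thesis
      using column_sizes_pos[OF nth_mem, of j b] by (auto simp: card_column_ribbon)
  qed
  have sz: "(\<forall>j. column (ribbon b) j \<noteq> {} \<longrightarrow> card (column (ribbon b) j) \<in> {1, 2})
      \<longleftrightarrow> no_double_descent b"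
    unfolding ne column_sizes_no_double[symmetric] card_column_ribbon
    by (auto simp: subset_iff in_set_conv_nth)
  \<comment> \<open>The condition \<open>0 < x\<close> leaves out the infinitely many empty columns,
    which have cardinality 0 as well.\<close>
  have "{j. card (column (ribbon b) j) = x} = {j. j < length (column_sizes b) \<and> column_sizes b ! j = x}"
    if "0 < x" for x
    using that by (auto simp: card_column_ribbon split: if_splits)
  then have cnt: "card {j. card (column (ribbon b) j) = x} = count_list (column_sizes b) x" if "0 < x" for x
    using that by (simp add: card_nth_eq)
  show ?thesis
    unfolding skew_hooks_def mem_Collect_eq sz card_ribbon hook_patterns_def
    using count_column_sizes[of b] cnt[of 1] cnt[of 2] skew_hook_ribbon normalized_ribbon by auto
qed

lemma bij_betw_ribbon:
  assumes "0 < n"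
  shows "bij_betw ribbon {b \<in> hook_patterns n. count_list b True = k} (skew_hooks n k)"
proof (rule bij_betw_imageI)
  show "inj_on ribbon {b \<in> hook_patterns n. count_list b True = k}"
    using ribbon_inject by (auto intro: inj_onI)
  show "ribbon ` {b \<in> hook_patterns n. count_list b True = k} = skew_hooks n k"
  proof
    show "skew_hooks n k \<subseteq> ribbon ` {b \<in> hook_patterns n. count_list b True = k}"
    proof
      fix D assume D: "D \<in> skew_hooks n k"
      then obtain b where "D = ribbon b"
        using skew_hook_eq_ribbon by (auto simp: skew_hooks_def)
      then show "D \<in> ribbon ` {b \<in> hook_patterns n. count_list b True = k}"
        using D ribbon_in_skew_hooks[OF assms] by auto
    qed
  qed (use ribbon_in_skew_hooks[OF assms] in auto)
qed

section \<open>Tableaux on a ribbon as words\<close>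

text \<open>The reading never goes down or left, so two cells in one row are joined by non-descents
  only and two cells in one column by descents only. The comparisons of neighbouring letters then
  chain.\<close>

lemma ribbon_cell_word_mono:
  assumes w: "\<And>i. i < length b \<Longrightarrow> (w ! i > w ! Suc i) = b ! i"
    and "p \<le> q" "q \<le> length b"
  shows "fst (ribbon_cell b q) \<le> fst (ribbon_cell b p) \<and> snd (ribbon_cell b p) \<le> snd (ribbon_cell b q) \<and>
    (fst (ribbon_cell b p) = fst (ribbon_cell b q) \<longrightarrow> w ! p \<le> w ! q) \<and>
    (snd (ribbon_cell b p) = snd (ribbon_cell b q) \<longrightarrow> p < q \<longrightarrow> (w ! q :: nat) < w ! p)"
  using assms(2,3)
proof (induction q rule: dec_induct)
  case (step q)
  then have q: "q < length b" by simp
  show ?case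
  proof (cases "b ! q")
    case True
    with step q w[OF q] ribbon_cell_True[OF q True] show ?thesis
      by (cases "p = q") auto
  next
    case False
    with step q w[OF q] ribbon_cell_False[OF q False] show ?thesis
      by (cases "p = q") auto
  qed
qed simp

lemma bij_betw_ssyt_words:
  "bij_betw (\<lambda>T. map (T \<circ> ribbon_cell b) [0..<Suc (length b)]) (ssyt (ribbon b)) (words (>) b)"
proof -
  define n where "n = length b"
  \<comment> \<open>The inverse of \<open>ribbon_cell\<close>, solved from
    \<open>ribbon_cell_diagonal\<close>.\<close>
  define ix where "ix c = snd c + count_list b True - fst c" for c
  have ix: "ix (ribbon_cell b p) = p" if "p \<le> n" for p
    using ribbon_cell_diagonal[of p b] that by (simp add: ix_def n_def)
  have cellE: "\<exists>p\<le>n. c = ribbon_cell b p" if "c \<in> ribbon b" for c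
    using that by (auto simp: ribbon_def n_def)
  have cell_in: "ribbon_cell b p \<in> ribbon b" if "p \<le> n" for p
    using that by (simp add: ribbon_def n_def)
  let ?f = "\<lambda>T. map (T \<circ> ribbon_cell b) [0..<Suc n]"
  let ?g = "\<lambda>w :: nat list. restrict (\<lambda>c. w ! ix c) (ribbon b)"
  have nth_f: "?f T ! p = T (ribbon_cell b p)" if "p \<le> n" for T :: "nat \<times> nat \<Rightarrow> nat" and p
    using that by (simp del: upt_Suc)
  have "bij_betw ?f (ssyt (ribbon b)) (words (>) b)"
  proof (rule bij_betw_byWitness[where f' = ?g])
    show "\<forall>T\<in>ssyt (ribbon b). ?g (?f T) = T"
    proof
      fix T assume T: "T \<in> ssyt (ribbon b)"
      show "?g (?f T) = T"
      proof
        fix c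
        show "?g (?f T) c = T c"
        proof (cases "c \<in> ribbon b")
          case True
          then obtain p where "p \<le> n" "c = ribbon_cell b p" using cellE by blast
          then show ?thesis using True ix[of p] nth_f[of p T] by (simp del: upt_Suc map_upt_Suc)
        next
          case False
          have "T \<in> ribbon b \<rightarrow>\<^sub>E UNIV" using T by (simp add: ssyt_def)
          then have "T c = undefined" using False by (rule PiE_arb)
          then show ?thesis using False by simp
        qed
      qed
    qed
    show "\<forall>w\<in>words (>) b. ?f (?g w) = w"
    proof
      fix w :: "nat list" assume "w \<in> words (>) b"
      then have len: "length w = Suc n" by (simp add: words_length n_def)
      show "?f (?g w) = w"
      proof (rule nth_equalityI)
        show "length (?f (?g w)) = length w" by (simp add: len)
        fix p assume "p < length (?f (?g w))"
        then have p: "p \<le> n" by simp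
        show "?f (?g w) ! p = w ! p"
          unfolding nth_f[OF p] using cell_in[OF p] ix[OF p] by simp
      qed
    qed
    show "?f ` ssyt (ribbon b) \<subseteq> words (>) b"
    proof
      fix w assume "w \<in> ?f ` ssyt (ribbon b)"
      then obtain T where T: "T \<in> ssyt (ribbon b)" and w: "w = ?f T" by blast
      have "(w ! i > w ! Suc i) = b ! i" if i: "i < length b" for i
      proof -
        obtain r c where rc: "ribbon_cell b (Suc i) = (r, c)" by fastforce
        have in_D: "ribbon_cell b i \<in> ribbon b" "(r, c) \<in> ribbon b"
          using cell_in[of i] cell_in[of "Suc i"] i rc by (auto simp: n_def)
        have nth: "w ! i = T (ribbon_cell b i)" "w ! Suc i = T (r, c)"
          using i nth_f[of i T] nth_f[of "Suc i" T] rc unfolding w n_def by (simp_all del: upt_Suc map_upt_Suc)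
        show ?thesis
        proof (cases "b ! i")
          case True
          then have "ribbon_cell b i = (Suc r, c)"
            using ribbon_cell_True[OF i True] rc by (simp add: prod_eq_iff)
          then have "T (r, c) < T (ribbon_cell b i)"
            using T in_D unfolding ssyt_def by (metis (mono_tags, lifting) lessI mem_Collect_eq)
          with nth True show ?thesis by simp
        next
          case False
          then obtain c' where "c = Suc c'" "ribbon_cell b i = (r, c')"
            using ribbon_cell_False[OF i False] rc by (metis fst_conv prod.collapse snd_conv)
          then have "T (ribbon_cell b i) \<le> T (r, c)"
            using T in_D unfolding ssyt_def by (metis (mono_tags, lifting) lessI mem_Collect_eq)
          with nth False show ?thesis by simp
        qed
      qed
      moreover have "length w = Suc (length b)" by (simp add: w n_def)
      ultimately show "w \<in> words (>) b" by (simp add: words_eq_nth)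
    qed
    show "?g ` words (>) b \<subseteq> ssyt (ribbon b)"
    proof
      fix T assume "T \<in> ?g ` words (>) b"
      then obtain w where "w \<in> words (>) b" and T: "T = ?g w" by blast
      then have w: "(w ! i > w ! Suc i) = b ! i" if "i < length b" for i
        using that by (simp add: words_eq_nth)
      have mono: "fst d \<le> fst c \<and> snd c \<le> snd d \<and> (fst c = fst d \<longrightarrow> T c \<le> T d) \<and>
          (snd c = snd d \<longrightarrow> c \<noteq> d \<longrightarrow> T d < T c)"
        if cd: "c \<in> ribbon b" "d \<in> ribbon b" "ix c \<le> ix d" for c d
      proof -
        obtain p q where pq: "p \<le> n" "q \<le> n" "c = ribbon_cell b p" "d = ribbon_cell b q"
          using cellE[OF cd(1)] cellE[OF cd(2)] by blast
        then have "p \<le> q" "T c = w ! p" "T d = w ! q" "c \<noteq> d \<longrightarrow> p \<noteq> q"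
          using cd ix by (auto simp: T)
        then show ?thesis
          using ribbon_cell_word_mono[of b w p q] w pq by (auto simp: n_def)
      qed
      have total: "ix c \<le> ix d \<or> ix d \<le> ix c" for c d by linarith
      have "T (i, j) \<le> T (i, j')" if "(i, j) \<in> ribbon b" "(i, j') \<in> ribbon b" "j < j'" for i j j'
        using mono[of "(i, j)" "(i, j')"] mono[of "(i, j')" "(i, j)"] total[of "(i, j)" "(i, j')"] that
        by auto
      moreover have "T (i, j) < T (i', j)" if "(i, j) \<in> ribbon b" "(i', j) \<in> ribbon b" "i < i'" for i i' j
        using mono[of "(i, j)" "(i', j)"] mono[of "(i', j)" "(i, j)"] total[of "(i, j)" "(i', j)"] that
        by auto
      moreover have "T \<in> ribbon b \<rightarrow>\<^sub>E UNIV" by (simp add: T)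
      ultimately show "T \<in> ssyt (ribbon b)" unfolding ssyt_def by blast
    qed
  qed
  then show ?thesis by (simp only: n_def)
qed

lemma skew_schur_ribbon: "skew_schur (ribbon b) = ribbon_fun b"
proof -
  have "mset_set (ribbon b) = image_mset (ribbon_cell b) (mset_set {..length b})"
    unfolding ribbon_def using inj_on_ribbon_cell by (rule image_mset_mset_set[symmetric])
  also have "mset_set {..length b} = mset [0..<Suc (length b)]"
    by (simp only: mset_upt atLeast0LessThan lessThan_Suc_atMost)
  finally have "mset_set (ribbon b) = image_mset (ribbon_cell b) (mset [0..<Suc (length b)])" .
  then have "mset (map (T \<circ> ribbon_cell b) [0..<Suc (length b)]) = image_mset T (mset_set (ribbon b))"
    for T :: "nat \<times> nat \<Rightarrow> nat"
    by (simp only: mset_map image_mset.compositionality)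
  then have "enumerator (ssyt (ribbon b)) (\<lambda>T. image_mset T (mset_set (ribbon b))) =
      enumerator (words (>) b) mset"
    by (intro enumerator_bij_betw[OF bij_betw_ssyt_words]) simp
  then show ?thesis
    by (simp add: skew_schur_def ribbon_fun_def enumerator_def)
qed

lemma gamma_tilde_eq:
  assumes "0 < n"
  shows "gamma_tilde n k = (\<Sum>b | b \<in> hook_patterns n \<and> count_list b True = k. ribbon_fun b)"
  unfolding gamma_tilde_def
  by (subst sum.reindex_bij_betw[OF bij_betw_ribbon[OF assms], symmetric]) (simp add: skew_schur_ribbon)

text \<open>The patterns are grouped by their number of descents, which \<open>count_True_le\<close>
  bounds by \<open>n div 2\<close>.\<close>

theorem hook_poly_eq_gamma:
  assumes "0 < n"
  shows "hook_poly x y n = (\<Sum>k=0..n div 2. smult (gamma_tilde n k) (y ^ k * x ^ (n - 2 * k)))"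
proof -
  have "hook_poly x y n =
      (\<Sum>k\<in>{0..n div 2}. \<Sum>b | b \<in> hook_patterns n \<and> count_list b True = k.
        smult (ribbon_fun b) (pattern_weight x y b))"
    unfolding hook_poly_def using assms
    by (simp, intro sum.group[symmetric] finite_hook_patterns)
       (auto simp: hook_patterns_def dest!: count_True_le)
  also have "\<dots> = (\<Sum>k=0..n div 2. smult (gamma_tilde n k) (y ^ k * x ^ (n - 2 * k)))"
    unfolding gamma_tilde_eq[OF assms] smult_sum
    by (intro sum.cong refl) (auto simp: pattern_weight_def hook_patterns_def)
  finally show ?thesis .
qed

section \<open>Horizontal strips and the Pieri rule\<close>

abbreviation cells :: "(nat \<Rightarrow> nat) \<Rightarrow> diagram" where
  "cells l \<equiv> skew_cells l (\<lambda>_. 0)"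

lemma cells_iff [simp]: "(i, j) \<in> cells l \<longleftrightarrow> j < l i"
  by (simp add: skew_cells_def)

lemma partition_antimono: "is_partition l \<Longrightarrow> i \<le> j \<Longrightarrow> l j \<le> l i"
  by (auto simp: is_partition_def antimono_def)

lemma partition_bound:
  assumes "is_partition l"
  obtains L where "\<And>i. L \<le> i \<Longrightarrow> l i = 0"
proof -
  from assms obtain L where "\<forall>i\<in>{i. l i \<noteq> 0}. i < L"
    by (auto simp: is_partition_def finite_nat_set_iff_bounded)
  then have "l i = 0" if "L \<le> i" for i
    using that not_less by blast
  then show ?thesis by (rule that)
qed

lemma card_cells:
  assumes "\<And>i. L \<le> i \<Longrightarrow> l i = 0"
  shows "card (cells l) = (\<Sum>i<L. l i)"
proof -
  have "cells l = (SIGMA i:{..<L}. {..<l i})"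
    using assms by (auto simp: skew_cells_def) (metis not_less not_less0)
  then show ?thesis by simp
qed

lemma finite_cells [simp]: "is_partition l \<Longrightarrow> finite (cells l)"
proof -
  assume "is_partition l"
  then obtain L where "\<And>i. L \<le> i \<Longrightarrow> l i = 0" using partition_bound by blast
  then have "cells l \<subseteq> (SIGMA i:{..<L}. {..<l i})"
    by (auto simp: skew_cells_def) (metis not_less not_less0)
  then show "finite (cells l)" by (rule finite_subset) simp
qed

lemma row_le_card_cells:
  assumes "is_partition l"
  shows "l i \<le> card (cells l)"
proof -
  have "Pair i ` {..<l i} \<subseteq> cells l" by auto
  then have "card (Pair i ` {..<l i}) \<le> card (cells l)"
    using assms by (intro card_mono) auto
  then show ?thesis by (simp add: card_image inj_on_def)
qed

text \<open>The second inequality says that no column of the difference of the shapes holds two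
  cells, the usual condition for a horizontal strip.\<close>

definition interlace :: "(nat \<Rightarrow> nat) \<Rightarrow> (nat \<Rightarrow> nat) \<Rightarrow> bool" where
  "interlace \<kappa> l \<longleftrightarrow> (\<forall>i. \<kappa> i \<le> l i \<and> l (Suc i) \<le> \<kappa> i)"

definition horizontal_strip :: "(nat \<Rightarrow> nat) \<Rightarrow> (nat \<Rightarrow> nat) \<Rightarrow> nat \<Rightarrow> bool" where
  "horizontal_strip \<kappa> l k \<longleftrightarrow> is_partition \<kappa> \<and> is_partition l \<and> interlace \<kappa> l \<and>
     card (cells l) = card (cells \<kappa>) + k"

text \<open>The chain \<open>l (Suc i) \<le> \<kappa> i \<le> l i\<close> makes both sequences
  decrease, and a shift by one bounds either support by the other. So new shapes are known to be
  partitions as soon as they interlace with an old one.\<close>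

lemma interlace_partition:
  assumes "interlace \<kappa> l" "finite {i. \<kappa> i \<noteq> 0} \<or> finite {i. l i \<noteq> 0}"
  shows "is_partition \<kappa>" "is_partition l"
proof -
  have "l (Suc i) \<le> l i" "\<kappa> (Suc i) \<le> \<kappa> i" for i
    using assms(1) order_trans unfolding interlace_def by blast+
  then have anti: "antimono l" "antimono \<kappa>"
    by (simp_all add: antimono_iff_le_Suc)
  have sub1: "{i. \<kappa> i \<noteq> 0} \<subseteq> {i. l i \<noteq> 0}"
    using assms(1) unfolding interlace_def by (metis (mono_tags, lifting) Collect_mono le_zero_eq)
  have sub2: "{i. l i \<noteq> 0} \<subseteq> insert 0 (Suc ` {i. \<kappa> i \<noteq> 0})"
  proof
    fix i assume i: "i \<in> {i. l i \<noteq> 0}"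
    show "i \<in> insert 0 (Suc ` {i. \<kappa> i \<noteq> 0})"
    proof (cases i)
      case (Suc n)
      have "l (Suc n) \<le> \<kappa> n" using assms(1) by (simp add: interlace_def)
      then have "n \<in> {i. \<kappa> i \<noteq> 0}" using i Suc by simp
      then show ?thesis unfolding Suc by blast
    qed simp
  qed
  have "finite {i. \<kappa> i \<noteq> 0} \<and> finite {i. l i \<noteq> 0}"
    using assms(2)
  proof
    assume fin: "finite {i. \<kappa> i \<noteq> 0}"
    show ?thesis
      using fin finite_subset[OF sub2 finite.insertI[OF finite_imageI[OF fin]]] by (rule conjI)
  next
    assume fin: "finite {i. l i \<noteq> 0}"
    show ?thesis
      using finite_subset[OF sub1 fin] fin by (rule conjI)
  qed
  with anti show "is_partition \<kappa>" "is_partition l"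
    by (simp_all add: is_partition_def)
qed

lemma finite_partitions_below:
  assumes "is_partition l"
  shows "finite {\<kappa>. \<forall>i. \<kappa> i \<le> (l i :: nat)}"
proof (rule finite_subset)
  let ?S = "{i. l i \<noteq> 0}"
  show "{\<kappa>. \<forall>i. \<kappa> i \<le> l i} \<subseteq> {f. \<forall>x. (x \<in> ?S \<longrightarrow> f x \<in> {..l 0}) \<and> (x \<notin> ?S \<longrightarrow> f x = 0)}"
    using partition_antimono[OF assms, of 0] by (auto intro: order_trans) (metis le_zero_eq)
  show "finite {f. \<forall>x. (x \<in> ?S \<longrightarrow> f x \<in> {..l 0}) \<and> (x \<notin> ?S \<longrightarrow> f x = 0)}"
    using assms by (intro finite_set_of_finite_funs) (auto simp: is_partition_def)
qed

lemma finite_horizontal_strip_inner: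
  assumes "is_partition l"
  shows "finite {\<kappa>. horizontal_strip \<kappa> l k}"
proof (rule finite_subset)
  show "{\<kappa>. horizontal_strip \<kappa> l k} \<subseteq> {\<kappa>. \<forall>i. \<kappa> i \<le> l i}"
    unfolding horizontal_strip_def interlace_def by blast
qed (rule finite_partitions_below[OF assms])

lemma finite_horizontal_strip_outer:
  assumes "is_partition \<kappa>"
  shows "finite {l. horizontal_strip \<kappa> l k}"
proof -
  \<comment> \<open>Interlacing bounds row \<open>Suc n\<close> of an outer shape by
    \<open>\<kappa> n\<close>; row 0 is bounded only by the number of cells.\<close>
  define u where "u i = (case i of 0 \<Rightarrow> card (cells \<kappa>) + k | Suc n \<Rightarrow> \<kappa> n)" for i
  have "l i \<le> u i" if "horizontal_strip \<kappa> l k" for l i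
    using that row_le_card_cells[of l 0]
    by (cases i) (auto simp: horizontal_strip_def interlace_def u_def)
  moreover have "is_partition u"
    unfolding is_partition_def
  proof
    show "antimono u"
      using partition_antimono[OF assms] row_le_card_cells[OF assms, of 0]
      by (auto simp: antimono_iff_le_Suc u_def split: nat.split)
    have "{i. u i \<noteq> 0} \<subseteq> insert 0 (Suc ` {i. \<kappa> i \<noteq> 0})"
    proof
      fix i assume "i \<in> {i. u i \<noteq> 0}"
      then show "i \<in> insert 0 (Suc ` {i. \<kappa> i \<noteq> 0})" by (cases i) (auto simp: u_def)
    qed
    then show "finite {i. u i \<noteq> 0}"
      by (rule finite_subset) (use assms in \<open>simp add: is_partition_def\<close>)
  qed
  ultimately show ?thesis
    by (intro finite_subset[OF _ finite_partitions_below[of u]]) auto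
qed

lemma ssyt_row: "T \<in> ssyt D \<Longrightarrow> (i, a) \<in> D \<Longrightarrow> (i, b) \<in> D \<Longrightarrow> a < b \<Longrightarrow> T (i, a) \<le> T (i, b)"
  unfolding ssyt_def by blast

lemma ssyt_col: "T \<in> ssyt D \<Longrightarrow> (a, i) \<in> D \<Longrightarrow> (b, i) \<in> D \<Longrightarrow> a < b \<Longrightarrow> T (a, i) < T (b, i)"
  unfolding ssyt_def by blast

lemma ssyt_outside: "T \<in> ssyt D \<Longrightarrow> c \<notin> D \<Longrightarrow> T c = undefined"
  unfolding ssyt_def by (blast dest: PiE_arb)

lemma mcoeff_schur:
  "mcoeff (schur l) m = real (card {T \<in> ssyt (cells l). image_mset T (mset_set (cells l)) = m})"
  by (simp add: schur_def skew_schur_def)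

lemma finite_ssyt_content:
  assumes "is_partition l"
  shows "finite {T \<in> ssyt (cells l). image_mset T (mset_set (cells l)) = m}"
proof (rule finite_subset)
  show "{T \<in> ssyt (cells l). image_mset T (mset_set (cells l)) = m} \<subseteq> cells l \<rightarrow>\<^sub>E set_mset m"
    using assms by (auto simp: ssyt_def PiE_iff extensional_def)
  show "finite (cells l \<rightarrow>\<^sub>E set_mset m)"
    using assms by (intro finite_PiE) auto
qed

text \<open>
  The entries below the largest possible one, \<open>N\<close>, form a tableau whose shape arises by removing a
  horizontal strip.
\<close>

lemma bij_betw_ssyt_remove_max:
  assumes l: "is_partition l" and m: "\<And>x. x \<in># m \<Longrightarrow> x < N"
  shows "bij_betw (\<lambda>(\<kappa>, T) c. if c \<in> cells l - cells \<kappa> then N else T c)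
    (SIGMA \<kappa>:{\<kappa>. horizontal_strip \<kappa> l j}.
      {T \<in> ssyt (cells \<kappa>). image_mset T (mset_set (cells \<kappa>)) = m})
    {T \<in> ssyt (cells l). image_mset T (mset_set (cells l)) = m + replicate_mset j N}"
    (is "bij_betw ?f ?A ?B")
proof -
  \<comment> \<open>The shape formed by the entries less than N.\<close>
  define sh where "sh T i = card {j. j < l i \<and> T (i, j) < N}" for T :: "nat \<times> nat \<Rightarrow> nat" and i
  let ?g = "\<lambda>T. (sh T, restrict T (cells (sh T)))"
  have f_props: "?f (\<kappa>, T) \<in> ?B \<and> sh (?f (\<kappa>, T)) = \<kappa> \<and> restrict (?f (\<kappa>, T)) (cells \<kappa>) = T"
    if \<kappa>: "horizontal_strip \<kappa> l j" and T: "T \<in> ssyt (cells \<kappa>)"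
      and cont: "image_mset T (mset_set (cells \<kappa>)) = m" for \<kappa> T
  proof -
    let ?T = "?f (\<kappa>, T)"
    have p: "is_partition \<kappa>" and il: "\<And>i. \<kappa> i \<le> l i" "\<And>i. l (Suc i) \<le> \<kappa> i"
      using \<kappa> by (auto simp: horizontal_strip_def interlace_def)
    have sub: "cells \<kappa> \<subseteq> cells l"
      using il(1) by (auto simp: skew_cells_def intro: less_le_trans)
    have small: "T c < N" if "c \<in> cells \<kappa>" for c
      using that p m cont by (metis finite_cells finite_set_mset_mset_set imageI set_image_mset)
    have T_out: "T c = undefined" if "c \<notin> cells \<kappa>" for c
      using ssyt_outside[OF T that] .
    have row: "T (i, a) \<le> T (i, b)" if "b < \<kappa> i" "a < b" for i a b
      using that by (intro ssyt_row[OF T]) auto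
    have col: "T (a, i) < T (b, i)" if "i < \<kappa> b" "a < b" for i a b
    proof -
      have "i < \<kappa> a" using partition_antimono[OF p, of a b] that by simp
      then show ?thesis using that by (intro ssyt_col[OF T]) auto
    qed
    have "?T \<in> ssyt (cells l)"
      unfolding ssyt_def
    proof (intro CollectI conjI allI impI)
      show "?T \<in> cells l \<rightarrow>\<^sub>E UNIV"
      proof -
        have "T c = undefined" if "c \<notin> cells l" for c
          using T_out sub that by blast
        then show ?thesis by (simp add: PiE_def extensional_def)
      qed
    next
      fix i a b assume "(i, a) \<in> cells l \<and> (i, b) \<in> cells l \<and> a < b"
      then show "?T (i, a) \<le> ?T (i, b)"
        using row[of b i a] small[of "(i, a)"] by auto
    next
      fix a b i assume ab: "(a, i) \<in> cells l \<and> (b, i) \<in> cells l \<and> a < b"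
      \<comment> \<open>So column i lies inside row a of \<open>\<kappa>\<close>: the upper entry is
        less than N, whether or not the lower one equals N.\<close>
      then have "l b \<le> \<kappa> a"
        using partition_antimono[OF l, of "Suc a" b] il(2)[of a] by simp
      with ab show "?T (a, i) < ?T (b, i)"
        using col[of i b a] small[of "(a, i)"] by auto
    qed
    moreover have "image_mset ?T (mset_set (cells l)) = m + replicate_mset j N"
    proof -
      have "mset_set (cells l) = mset_set (cells \<kappa>) + mset_set (cells l - cells \<kappa>)"
        using mset_set_Union[of "cells \<kappa>" "cells l - cells \<kappa>"] sub l p
        by (simp add: Un_absorb1)
      moreover have "image_mset ?T (mset_set (cells \<kappa>)) = image_mset T (mset_set (cells \<kappa>))"
        using p by (intro image_mset_cong) auto
      moreover have "image_mset ?T (mset_set (cells l - cells \<kappa>)) =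
          image_mset (\<lambda>_. N) (mset_set (cells l - cells \<kappa>))"
        using l by (intro image_mset_cong) auto
      moreover have "card (cells l - cells \<kappa>) = j"
        using \<kappa> sub p l by (simp add: card_Diff_subset horizontal_strip_def)
      ultimately show ?thesis
        using cont by (simp add: image_mset_const_eq)
    qed
    moreover have "sh ?T = \<kappa>"
    proof
      fix i
      have "{j. j < l i \<and> ?T (i, j) < N} = {..<\<kappa> i}"
        using il(1)[of i] small[of "(i, _)"] by auto
      then show "sh ?T i = \<kappa> i" by (simp add: sh_def)
    qed
    moreover have "restrict ?T (cells \<kappa>) = T"
      using T_out by (auto simp: restrict_def)
    ultimately show ?thesis by blast
  qed
  have g_props: "horizontal_strip (sh T) l j \<and> restrict T (cells (sh T)) \<in> ssyt (cells (sh T)) \<and>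
      image_mset (restrict T (cells (sh T))) (mset_set (cells (sh T))) = m \<and> ?f (?g T) = T"
    if T: "T \<in> ssyt (cells l)" and cont: "image_mset T (mset_set (cells l)) = m + replicate_mset j N" for T
  proof -
    let ?\<kappa> = "sh T"
    have row: "T (i, a) \<le> T (i, b)" if "b < l i" "a < b" for i a b
      using that by (intro ssyt_row[OF T]) auto
    have col: "T (a, i) < T (b, i)" if "i < l b" "a < b" for i a b
    proof -
      have "i < l a" using partition_antimono[OF l, of a b] that by simp
      then show ?thesis using that by (intro ssyt_col[OF T]) auto
    qed
    have le: "T c \<le> N" if "c \<in> cells l" for c
    proof -
      have "T c \<in># m + replicate_mset j N"
        using that l by (simp flip: cont)
      then show ?thesis using m by (auto split: if_splits intro: less_imp_le)
    qed
    \<comment> \<open>Rows increase weakly, so the entries less than N form an initial segment of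
      the row.\<close>
    have initial: "{j. j < l i \<and> T (i, j) < N} = {..<?\<kappa> i}" for i
    proof -
      let ?S = "{j. j < l i \<and> T (i, j) < N}"
      have down: "a \<in> ?S" if "b \<in> ?S" "a < b" for a b
        using that row[of b i a] by auto
      have "finite ?S" by (rule finite_subset[of _ "{..<l i}"]) auto
      then have "?S = {..<card ?S}"
      proof (cases "?S = {}")
        case False
        with \<open>finite ?S\<close> have "Max ?S \<in> ?S" by (rule Max_in)
        with \<open>finite ?S\<close> have "?S = {..Max ?S}"
          using down[of "Max ?S"] Max_ge[of ?S] by (intro set_eqI iffI) (auto simp: le_less)
        then show ?thesis by (metis card_atMost lessThan_Suc_atMost)
      qed (simp only: card.empty lessThan_0)
      then show ?thesis by (simp only: sh_def)
    qed
    have \<kappa>: "j < ?\<kappa> i \<longleftrightarrow> j < l i \<and> T (i, j) < N" for i j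
      using initial[of i] by blast
    have \<kappa>_cells: "c \<in> cells ?\<kappa> \<longleftrightarrow> c \<in> cells l \<and> T c < N" for c
      using \<kappa> by (cases c) simp
    have il: "interlace ?\<kappa> l"
      unfolding interlace_def
    proof (intro allI conjI)
      fix i
      show "?\<kappa> i \<le> l i" using \<kappa>[of "l i" i] by (meson leI less_irrefl)
      \<comment> \<open>Columns increase strictly, so N cannot occur twice in one column.\<close>
      show "l (Suc i) \<le> ?\<kappa> i"
      proof (rule ccontr)
        assume "\<not> ?thesis"
        then have lt: "?\<kappa> i < l (Suc i)" by simp
        then have "T (i, ?\<kappa> i) < T (Suc i, ?\<kappa> i)" by (intro col) auto
        moreover have "T (Suc i, ?\<kappa> i) \<le> N" using lt by (intro le) simp
        moreover have "?\<kappa> i < l i" using lt partition_antimono[OF l, of i "Suc i"] by simp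
        ultimately show False using \<kappa>[of "?\<kappa> i" i] by simp
      qed
    qed
    then have p: "is_partition ?\<kappa>"
      using interlace_partition[OF il] l by (auto simp: is_partition_def)
    have filt: "mset_set (cells ?\<kappa>) = filter_mset (\<lambda>c. T c < N) (mset_set (cells l))"
      using l \<kappa>_cells by (subst filter_mset_mset_set) (auto intro!: arg_cong[where f = mset_set])
    have "image_mset T (mset_set (cells ?\<kappa>)) = filter_mset (\<lambda>x. x < N) (m + replicate_mset j N)"
      unfolding filt cont[symmetric] by (simp add: filter_mset_image_mset)
    also have "\<dots> = m"
    proof -
      have "filter_mset (\<lambda>x. x < N) m = filter_mset (\<lambda>_. True) m"
        using m by (intro filter_mset_cong) auto
      moreover have "filter_mset (\<lambda>x. x < N) (replicate_mset j N) = {#}"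
        by (induction j) auto
      ultimately show ?thesis by simp
    qed
    finally have cont': "image_mset T (mset_set (cells ?\<kappa>)) = m" .
    have "image_mset (restrict T (cells ?\<kappa>)) (mset_set (cells ?\<kappa>)) = image_mset T (mset_set (cells ?\<kappa>))"
      using p by (intro image_mset_cong) auto
    with cont' have cont'': "image_mset (restrict T (cells ?\<kappa>)) (mset_set (cells ?\<kappa>)) = m" by simp
    have "card (cells l) = size m + j"
      using arg_cong[OF cont, of size] by simp
    moreover have "card (cells ?\<kappa>) = size m"
      using arg_cong[OF cont', of size] by simp
    ultimately have hs: "horizontal_strip ?\<kappa> l j"
      using p l il by (simp add: horizontal_strip_def)
    have ss: "restrict T (cells ?\<kappa>) \<in> ssyt (cells ?\<kappa>)"
      unfolding ssyt_def
      using row col \<kappa> by auto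
    have "?f (?g T) = T"
    proof
      fix c
      consider "c \<in> cells ?\<kappa>" | "c \<in> cells l" "c \<notin> cells ?\<kappa>" | "c \<notin> cells l" "c \<notin> cells ?\<kappa>"
        by blast
      then show "?f (?g T) c = T c"
      proof cases
        case 2
        then have "T c = N" using le[of c] \<kappa>_cells[of c] by simp
        then show ?thesis using 2 by simp
      next
        case 3
        have "T c = undefined" using T 3(1) by (rule ssyt_outside)
        then show ?thesis using 3 by simp
      qed simp
    qed
    then show ?thesis using hs ss cont'' by blast
  qed
  show ?thesis
  proof (rule bij_betw_byWitness[where f' = ?g])
    show "\<forall>a\<in>?A. ?g (?f a) = a"
    proof
      fix a assume "a \<in> ?A"
      then obtain \<kappa> T where a: "a = (\<kappa>, T)" and "horizontal_strip \<kappa> l j" "T \<in> ssyt (cells \<kappa>)"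
        "image_mset T (mset_set (cells \<kappa>)) = m" by blast
      from f_props[OF this(2-)] show "?g (?f a) = a" unfolding a by metis
    qed
    show "\<forall>T\<in>?B. ?f (?g T) = T"
      using g_props by blast
    show "?f ` ?A \<subseteq> ?B" using f_props by blast
    show "?g ` ?B \<subseteq> ?A" using g_props by blast
  qed
qed

text \<open>The branching rule for Schur functions: it takes one variable away in the induction for
  the Pieri rule.\<close>

lemma mcoeff_schur_remove_max:
  assumes "is_partition l" "\<And>x. x \<in># m \<Longrightarrow> x < N"
  shows "mcoeff (schur l) (m + replicate_mset j N) =
    (\<Sum>\<kappa> | horizontal_strip \<kappa> l j. mcoeff (schur \<kappa>) m)"
proof -
  have "card {T \<in> ssyt (cells l). image_mset T (mset_set (cells l)) = m + replicate_mset j N} =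
      card (SIGMA \<kappa>:{\<kappa>. horizontal_strip \<kappa> l j}.
        {T \<in> ssyt (cells \<kappa>). image_mset T (mset_set (cells \<kappa>)) = m})"
    by (rule bij_betw_same_card[OF bij_betw_ssyt_remove_max[OF assms], symmetric])
  also have "\<dots> = (\<Sum>\<kappa> | horizontal_strip \<kappa> l j.
      card {T \<in> ssyt (cells \<kappa>). image_mset T (mset_set (cells \<kappa>)) = m})"
    using assms(1) by (intro card_SigmaI finite_horizontal_strip_inner ballI finite_ssyt_content)
      (auto simp: horizontal_strip_def)
  finally show ?thesis by (simp add: mcoeff_schur)
qed

text \<open>As m is free of N, a factorization is determined by the number i of copies of N in the
  first factor and a factorization of m.\<close>

lemma mcoeff_mult_replicate:
  assumes "N \<notin># m"
  shows "mcoeff (f * g) (m + replicate_mset j N) =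
    (\<Sum>i\<le>j. \<Sum>p | fst p + snd p = m.
      mcoeff f (fst p + replicate_mset i N) * mcoeff g (snd p + replicate_mset (j - i) N))"
proof -
  let ?I = "{p :: nat multiset \<times> nat multiset. fst p + snd p = m}"
  let ?J = "{p :: nat multiset \<times> nat multiset. fst p + snd p = m + replicate_mset j N}"
  let ?t = "\<lambda>p. mcoeff f (fst p) * mcoeff g (snd p)"
  have fin: "finite ?I" using finite_add_decomp[of m] by (simp add: case_prod_unfold)
  let ?h = "\<lambda>(i, p). (fst p + replicate_mset i N, snd p + replicate_mset (j - i) N)"
  let ?k = "\<lambda>p. (count (fst p) N, (filter_mset (\<lambda>x. x \<noteq> N) (fst p), filter_mset (\<lambda>x. x \<noteq> N) (snd p)))"
  have noN: "filter_mset (\<lambda>x. x \<noteq> N) a = a" if "N \<notin># a" for a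
    using that by (simp add: filter_mset_eq_conv) (metis (full_types) diff_empty)
  have split: "filter_mset (\<lambda>x. x \<noteq> N) a + replicate_mset (count a N) N = a" for a
    by (rule multiset_eqI) simp
  have "(\<Sum>i\<le>j. \<Sum>p\<in>?I. ?t (?h (i, p))) = (\<Sum>x\<in>{..j} \<times> ?I. ?t (?h x))"
    by (simp add: sum.cartesian_product case_prod_unfold)
  also have "\<dots> = (\<Sum>p\<in>?J. ?t p)"
  proof (rule sum.reindex_bij_witness[where i = ?k and j = ?h])
    fix x assume x: "x \<in> {..j} \<times> ?I"
    then obtain i a b where x': "x = (i, (a, b))" "i \<le> j" "a + b = m" by auto
    then have "N \<notin># a" "N \<notin># b" using assms by auto
    then show "?k (?h x) = x"
      using noN by (simp add: x'(1) not_in_iff)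
    show "?h x \<in> ?J"
      using x' by (auto simp: multiset_eq_iff)
  next
    fix p assume p: "p \<in> ?J"
    then have cnt: "count (fst p) y + count (snd p) y = count m y + (if y = N then j else 0)" for y
      by (auto simp: multiset_eq_iff)
    have cN: "count m N = 0" using assms by (simp add: not_in_iff)
    then have c: "count (snd p) N = j - count (fst p) N" "count (fst p) N \<le> j"
      using cnt[of N] by auto
    show "?k p \<in> {..j} \<times> ?I"
    proof -
      have "count (filter_mset (\<lambda>x. x \<noteq> N) (fst p) + filter_mset (\<lambda>x. x \<noteq> N) (snd p)) y = count m y" for y
        using cnt[of y] cN by (cases "y = N") auto
      then show ?thesis using c by (simp add: multiset_eq_iff)
    qed
    show "?h (?k p) = p"
      using split[of "fst p"] split[of "snd p"] c(1) by (simp add: prod_eq_iff)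
  qed simp
  also have "\<dots> = mcoeff (f * g) (m + replicate_mset j N)"
    by (simp add: mcoeff_mult case_prod_unfold)
  finally show ?thesis by (simp add: case_prod_unfold)
qed

lemma interlace_cells:
  assumes "interlace \<kappa> l"
  shows "cells \<kappa> \<subseteq> cells l"
proof clarify
  fix i j assume "(i, j) \<in> cells \<kappa>"
  moreover have "\<kappa> i \<le> l i" using assms by (simp add: interlace_def)
  ultimately show "(i, j) \<in> cells l" by simp
qed

text \<open>
  Fomin's local rule for the Robinson--Schensted--Knuth correspondence: for fixed \<open>\<mu>\<close> and \<open>\<rho>\<close>, the
  conditions on \<open>\<nu>\<^sub>n\<^sub>+\<^sub>1\<close> and those on \<open>\<kappa>\<^sub>n\<close> describe the same interval, which is reflected.
\<close>

lemma local_rule_interlace: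
  fixes \<mu> \<rho> \<kappa> \<nu> :: "nat \<Rightarrow> nat"
  assumes rule: "\<And>n. \<nu> (Suc n) + \<kappa> n = max (\<mu> (Suc n)) (\<rho> (Suc n)) + min (\<mu> n) (\<rho> n)"
    and \<nu>0: "max (\<mu> 0) (\<rho> 0) \<le> \<nu> 0"
  shows "interlace \<kappa> \<mu> \<and> interlace \<kappa> \<rho> \<longleftrightarrow> interlace \<mu> \<nu> \<and> interlace \<rho> \<nu>"
proof -
  have lower: "(\<forall>n. \<mu> n \<le> \<nu> n \<and> \<rho> n \<le> \<nu> n) \<longleftrightarrow> (\<forall>n. \<kappa> n \<le> \<mu> n \<and> \<kappa> n \<le> \<rho> n)"
  proof -
    have "\<mu> (Suc n) \<le> \<nu> (Suc n) \<and> \<rho> (Suc n) \<le> \<nu> (Suc n) \<longleftrightarrow> \<kappa> n \<le> \<mu> n \<and> \<kappa> n \<le> \<rho> n" for n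
      using rule[of n] by linarith
    moreover have "(\<forall>n. \<mu> n \<le> \<nu> n \<and> \<rho> n \<le> \<nu> n) \<longleftrightarrow> (\<forall>n. \<mu> (Suc n) \<le> \<nu> (Suc n) \<and> \<rho> (Suc n) \<le> \<nu> (Suc n))"
      using \<nu>0 by (metis max.bounded_iff not0_implies_Suc)
    ultimately show ?thesis by simp
  qed
  have upper: "\<nu> (Suc n) \<le> \<mu> n \<and> \<nu> (Suc n) \<le> \<rho> n \<longleftrightarrow> \<mu> (Suc n) \<le> \<kappa> n \<and> \<rho> (Suc n) \<le> \<kappa> n" for n
    using rule[of n] by linarith
  show ?thesis
    unfolding interlace_def using lower upper by blast
qed

text \<open>Since max a b + min a b = a + b, summing the rule over all rows counts cells. The maxima
  in the rule start at row 1; row 0 of \<open>\<nu>\<close> supplies the missing one together with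
  d.\<close>

lemma local_rule_size:
  assumes p: "is_partition \<mu>" "is_partition \<rho>" "is_partition \<kappa>" "is_partition \<nu>"
    and rule: "\<And>n. \<nu> (Suc n) + \<kappa> n = max (\<mu> (Suc n)) (\<rho> (Suc n)) + min (\<mu> n) (\<rho> n)"
    and \<nu>0: "\<nu> 0 = max (\<mu> 0) (\<rho> 0) + d"
  shows "card (cells \<nu>) + card (cells \<kappa>) = card (cells \<mu>) + card (cells \<rho>) + d"
proof -
  obtain L1 L2 L3 L4 where "\<And>i. L1 \<le> i \<Longrightarrow> \<mu> i = 0" "\<And>i. L2 \<le> i \<Longrightarrow> \<rho> i = 0"
    "\<And>i. L3 \<le> i \<Longrightarrow> \<kappa> i = 0" "\<And>i. L4 \<le> i \<Longrightarrow> \<nu> i = 0"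
    using partition_bound[OF p(1)] partition_bound[OF p(2)] partition_bound[OF p(3)]
      partition_bound[OF p(4)] by metis
  moreover define L where "L = L1 + L2 + L3 + L4"
  ultimately have L: "\<mu> i = 0" "\<rho> i = 0" "\<kappa> i = 0" "\<nu> i = 0" if "L \<le> i" for i
    using that by simp_all
  have "card (cells \<nu>) + card (cells \<kappa>) = (\<Sum>i<Suc L. \<nu> i) + (\<Sum>i<L. \<kappa> i)"
    using card_cells[of "Suc L" \<nu>] card_cells[of L \<kappa>] L by simp
  also have "\<dots> = \<nu> 0 + (\<Sum>i<L. \<nu> (Suc i) + \<kappa> i)"
    by (simp only: sum.lessThan_Suc_shift sum.distrib add.assoc)
  also have "\<dots> = d + (max (\<mu> 0) (\<rho> 0) + (\<Sum>i<L. max (\<mu> (Suc i)) (\<rho> (Suc i)))) + (\<Sum>i<L. min (\<mu> i) (\<rho> i))"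
    by (simp add: rule \<nu>0 sum.distrib)
  also have "max (\<mu> 0) (\<rho> 0) + (\<Sum>i<L. max (\<mu> (Suc i)) (\<rho> (Suc i))) = (\<Sum>i<Suc L. max (\<mu> i) (\<rho> i))"
    by (simp only: sum.lessThan_Suc_shift)
  also have "\<dots> = (\<Sum>i<L. max (\<mu> i) (\<rho> i))"
    using L by simp
  also have "d + (\<Sum>i<L. max (\<mu> i) (\<rho> i)) + (\<Sum>i<L. min (\<mu> i) (\<rho> i)) =
      d + (\<Sum>i<L. max (\<mu> i) (\<rho> i) + min (\<mu> i) (\<rho> i))"
    by (simp add: sum.distrib)
  also have "(\<lambda>i. max (\<mu> i) (\<rho> i) + min (\<mu> i) (\<rho> i)) = (\<lambda>i. \<mu> i + \<rho> i)"
    by (auto simp: max_def min_def)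
  also have "d + (\<Sum>i<L. \<mu> i + \<rho> i) = card (cells \<mu>) + card (cells \<rho>) + d"
    using card_cells[of L \<mu>] card_cells[of L \<rho>] L by (simp add: sum.distrib)
  finally show ?thesis .
qed

text \<open>Removing and then adding a strip is traded for adding and then removing, by a bijection
  that fixes \<open>\<rho>\<close>. The local rule determines every row of \<open>\<nu>\<close> but
  the first, whose excess \<open>j - i\<close> over the maximum stores the index i.\<close>

lemma sum_local_rule:
  assumes \<mu>: "is_partition \<mu>"
  shows "(\<Sum>i | i \<le> j \<and> j \<le> i + k. \<Sum>\<kappa> | horizontal_strip \<kappa> \<mu> i.
      \<Sum>\<rho> | horizontal_strip \<kappa> \<rho> (i + k - j). f \<rho>) =
    (\<Sum>\<nu> | horizontal_strip \<mu> \<nu> k. \<Sum>\<rho> | horizontal_strip \<rho> \<nu> j. f \<rho> :: real)"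
proof -
  let ?A = "SIGMA i:{i. i \<le> j \<and> j \<le> i + k}. SIGMA \<kappa>:{\<kappa>. horizontal_strip \<kappa> \<mu> i}.
      {\<rho>. horizontal_strip \<kappa> \<rho> (i + k - j)}"
  let ?B = "SIGMA \<nu>:{\<nu>. horizontal_strip \<mu> \<nu> k}. {\<rho>. horizontal_strip \<rho> \<nu> j}"
  \<comment> \<open>\<open>up\<close> and \<open>down\<close> solve the local rule for
    \<open>\<nu>\<close> and for \<open>\<kappa>\<close>. Interlacing bounds what is subtracted by
    \<open>min (\<mu> n) (\<rho> n)\<close>, so the differences are exact.\<close>
  define up where "up i \<kappa> \<rho> n = (case n of 0 \<Rightarrow> max (\<mu> 0) (\<rho> 0) + (j - i)
    | Suc n \<Rightarrow> max (\<mu> (Suc n)) (\<rho> (Suc n)) + min (\<mu> n) (\<rho> n) - \<kappa> n)" for i :: nat and \<kappa> \<rho> :: "nat \<Rightarrow> nat" and n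
  define down where "down \<nu> \<rho> n = max (\<mu> (Suc n)) (\<rho> (Suc n)) + min (\<mu> n) (\<rho> n) - \<nu> (Suc n)"
    for \<nu> \<rho> :: "nat \<Rightarrow> nat" and n
  define di where "di \<nu> \<rho> = j - (\<nu> 0 - max (\<mu> 0) (\<rho> 0))" for \<nu> \<rho> :: "nat \<Rightarrow> nat"
  have up: "horizontal_strip \<mu> (up i \<kappa> \<rho>) k \<and> horizontal_strip \<rho> (up i \<kappa> \<rho>) j \<and>
      down (up i \<kappa> \<rho>) \<rho> = \<kappa> \<and> di (up i \<kappa> \<rho>) \<rho> = i"
    if i: "i \<le> j" "j \<le> i + k" and h: "horizontal_strip \<kappa> \<mu> i" "horizontal_strip \<kappa> \<rho> (i + k - j)" for i \<kappa> \<rho>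
  proof -
    let ?\<nu> = "up i \<kappa> \<rho>"
    have il: "interlace \<kappa> \<mu>" "interlace \<kappa> \<rho>" and p: "is_partition \<rho>" "is_partition \<kappa>"
      using h by (simp_all add: horizontal_strip_def)
    then have "\<kappa> n \<le> \<mu> n" "\<kappa> n \<le> \<rho> n" for n by (auto simp: interlace_def)
    then have rule: "?\<nu> (Suc n) + \<kappa> n = max (\<mu> (Suc n)) (\<rho> (Suc n)) + min (\<mu> n) (\<rho> n)" for n
      by (simp add: up_def trans_le_add2)
    have \<nu>0: "?\<nu> 0 = max (\<mu> 0) (\<rho> 0) + (j - i)"
      by (simp add: up_def)
    have il': "interlace \<mu> ?\<nu>" "interlace \<rho> ?\<nu>"
      using local_rule_interlace[of ?\<nu> \<kappa> \<mu> \<rho>] rule \<nu>0 il by simp_all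
    have p\<nu>: "is_partition ?\<nu>"
      using interlace_partition[OF il'(1)] \<mu> by (simp add: is_partition_def)
    have "card (cells ?\<nu>) + card (cells \<kappa>) = card (cells \<mu>) + card (cells \<rho>) + (j - i)"
      using local_rule_size[OF \<mu> p p\<nu> rule \<nu>0] .
    then have "card (cells ?\<nu>) = card (cells \<mu>) + k" "card (cells ?\<nu>) = card (cells \<rho>) + j"
      using h i by (simp_all add: horizontal_strip_def)
    moreover have "down ?\<nu> \<rho> n = \<kappa> n" for n
      unfolding down_def rule[symmetric] by simp
    moreover have "di ?\<nu> \<rho> = i" using \<nu>0 i by (simp add: di_def)
    ultimately show ?thesis
      using il' p\<nu> p \<mu> by (simp add: horizontal_strip_def fun_eq_iff)
  qed
  have down: "di \<nu> \<rho> \<le> j \<and> j \<le> di \<nu> \<rho> + k \<and> horizontal_strip (down \<nu> \<rho>) \<mu> (di \<nu> \<rho>) \<and>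
      horizontal_strip (down \<nu> \<rho>) \<rho> (di \<nu> \<rho> + k - j) \<and> up (di \<nu> \<rho>) (down \<nu> \<rho>) \<rho> = \<nu>"
    if h: "horizontal_strip \<mu> \<nu> k" "horizontal_strip \<rho> \<nu> j" for \<nu> \<rho>
  proof -
    let ?\<kappa> = "down \<nu> \<rho>"
    define d where "d = \<nu> 0 - max (\<mu> 0) (\<rho> 0)"
    have il: "interlace \<mu> \<nu>" "interlace \<rho> \<nu>" and p: "is_partition \<rho>" "is_partition \<nu>"
      using h by (simp_all add: horizontal_strip_def)
    then have le: "\<nu> (Suc n) \<le> \<mu> n" "\<nu> (Suc n) \<le> \<rho> n" "\<mu> n \<le> \<nu> n" "\<rho> n \<le> \<nu> n" for n
      by (auto simp: interlace_def)
    then have rule: "\<nu> (Suc n) + ?\<kappa> n = max (\<mu> (Suc n)) (\<rho> (Suc n)) + min (\<mu> n) (\<rho> n)" for n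
      by (simp add: down_def trans_le_add2)
    have \<nu>0: "\<nu> 0 = max (\<mu> 0) (\<rho> 0) + d"
      using le(3,4)[of 0] by (simp add: d_def)
    have il': "interlace ?\<kappa> \<mu>" "interlace ?\<kappa> \<rho>"
      using local_rule_interlace[of \<nu> ?\<kappa> \<mu> \<rho>] rule \<nu>0 il by simp_all
    have p\<kappa>: "is_partition ?\<kappa>"
      using interlace_partition[OF il'(1)] \<mu> by (simp add: is_partition_def)
    have size: "card (cells \<nu>) + card (cells ?\<kappa>) = card (cells \<mu>) + card (cells \<rho>) + d"
      using local_rule_size[OF \<mu> p(1) p\<kappa> p(2) rule \<nu>0] .
    \<comment> \<open>Containment of \<open>\<kappa>\<close> in both shapes turns the size equation
      into d \<le> j and d \<le> k.\<close>
    have "cells ?\<kappa> \<subseteq> cells \<mu>" "cells ?\<kappa> \<subseteq> cells \<rho>"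
      using il' interlace_cells by blast+
    then have "card (cells ?\<kappa>) \<le> card (cells \<mu>)" "card (cells ?\<kappa>) \<le> card (cells \<rho>)"
      using \<mu> p by (simp_all add: card_mono)
    moreover have "card (cells \<nu>) = card (cells \<mu>) + k" "card (cells \<nu>) = card (cells \<rho>) + j"
      using h by (simp_all add: horizontal_strip_def)
    ultimately have d: "d \<le> j" "d \<le> k" "card (cells \<mu>) = card (cells ?\<kappa>) + (j - d)"
      "card (cells \<rho>) = card (cells ?\<kappa>) + (k - d)"
      using size by linarith+
    have di: "di \<nu> \<rho> = j - d" by (simp add: di_def d_def)
    have "up (di \<nu> \<rho>) ?\<kappa> \<rho> n = \<nu> n" for n
    proof (cases n)
      case 0
      then show ?thesis using \<nu>0 d by (simp add: up_def di)
    next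
      case (Suc q)
      then show ?thesis using rule[of q, symmetric] by (simp add: up_def)
    qed
    moreover have "j - d + k - j = k - d" using d by simp
    ultimately show ?thesis
      using d il' p\<kappa> p \<mu> by (simp add: horizontal_strip_def di fun_eq_iff)
  qed
  have "(\<Sum>i | i \<le> j \<and> j \<le> i + k. \<Sum>\<kappa> | horizontal_strip \<kappa> \<mu> i.
      \<Sum>\<rho> | horizontal_strip \<kappa> \<rho> (i + k - j). f \<rho>) = (\<Sum>(i, \<kappa>, \<rho>)\<in>?A. f \<rho>)"
  proof -
    have fin: "finite (SIGMA \<kappa>:{\<kappa>. horizontal_strip \<kappa> \<mu> i}. {\<rho>. horizontal_strip \<kappa> \<rho> (i + k - j)})" for i
      by (intro finite_SigmaI finite_horizontal_strip_inner \<mu> finite_horizontal_strip_outer)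
        (simp add: horizontal_strip_def)
    have "(\<Sum>\<kappa> | horizontal_strip \<kappa> \<mu> i. \<Sum>\<rho> | horizontal_strip \<kappa> \<rho> (i + k - j). f \<rho>) =
        (\<Sum>(\<kappa>, \<rho>)\<in>(SIGMA \<kappa>:{\<kappa>. horizontal_strip \<kappa> \<mu> i}. {\<rho>. horizontal_strip \<kappa> \<rho> (i + k - j)}). f \<rho>)" for i
      by (intro sum.Sigma finite_horizontal_strip_inner \<mu> ballI finite_horizontal_strip_outer)
        (simp add: horizontal_strip_def)
    then show ?thesis
      using fin by (simp add: sum.Sigma)
  qed
  also have "\<dots> = (\<Sum>(\<nu>, \<rho>)\<in>?B. f \<rho>)"
  proof (rule sum.reindex_bij_witness[where j = "\<lambda>(i, \<kappa>, \<rho>). (up i \<kappa> \<rho>, \<rho>)"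
        and i = "\<lambda>(\<nu>, \<rho>). (di \<nu> \<rho>, down \<nu> \<rho>, \<rho>)"])
    fix x assume "x \<in> ?A"
    then obtain i \<kappa> \<rho> where x: "x = (i, \<kappa>, \<rho>)" and h: "i \<le> j" "j \<le> i + k"
      "horizontal_strip \<kappa> \<mu> i" "horizontal_strip \<kappa> \<rho> (i + k - j)" by blast
    note u = up[OF h]
    show "(case case x of (i, \<kappa>, \<rho>) \<Rightarrow> (up i \<kappa> \<rho>, \<rho>) of (\<nu>, \<rho>) \<Rightarrow> (di \<nu> \<rho>, down \<nu> \<rho>, \<rho>)) = x"
      using u by (simp add: x)
    show "(case x of (i, \<kappa>, \<rho>) \<Rightarrow> (up i \<kappa> \<rho>, \<rho>)) \<in> ?B"
      using u by (simp add: x)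
    show "(case case x of (i, \<kappa>, \<rho>) \<Rightarrow> (up i \<kappa> \<rho>, \<rho>) of (\<nu>, \<rho>) \<Rightarrow> f \<rho>) = (case x of (i, \<kappa>, \<rho>) \<Rightarrow> f \<rho>)"
      by (simp add: x)
  next
    fix y assume "y \<in> ?B"
    then obtain \<nu> \<rho> where y: "y = (\<nu>, \<rho>)" and h: "horizontal_strip \<mu> \<nu> k" "horizontal_strip \<rho> \<nu> j"
      by blast
    note d = down[OF h]
    show "(case case y of (\<nu>, \<rho>) \<Rightarrow> (di \<nu> \<rho>, down \<nu> \<rho>, \<rho>) of (i, \<kappa>, \<rho>) \<Rightarrow> (up i \<kappa> \<rho>, \<rho>)) = y"
      using d by (simp add: y)
    show "(case y of (\<nu>, \<rho>) \<Rightarrow> (di \<nu> \<rho>, down \<nu> \<rho>, \<rho>)) \<in> ?A"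
      using d by (simp add: y)
  qed
  also have "\<dots> = (\<Sum>\<nu> | horizontal_strip \<mu> \<nu> k. \<Sum>\<rho> | horizontal_strip \<rho> \<nu> j. f \<rho>)"
    by (intro sum.Sigma[symmetric] finite_horizontal_strip_outer \<mu> ballI finite_horizontal_strip_inner)
      (simp add: horizontal_strip_def)
  finally show ?thesis .
qed

lemma mcoeff_hsym: "mcoeff (hsym k) m = (if size m = k then 1 else 0)"
  by (simp add: hsym_def)

lemma mcoeff_schur_empty:
  assumes "is_partition l"
  shows "mcoeff (schur l) {#} = (if l = (\<lambda>_. 0) then 1 else 0)"
proof (cases "l = (\<lambda>_. 0)")
  case True
  then have c: "cells l = {}" by (simp add: skew_cells_def)
  have "ssyt {} = {\<lambda>_. undefined}" by (auto simp: ssyt_def)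
  with c True show ?thesis by (simp add: mcoeff_schur)
next
  case False
  then obtain i where "l i \<noteq> 0" by (auto simp: fun_eq_iff)
  then have "(i, 0) \<in> cells l" by simp
  then have "mset_set (cells l) \<noteq> {#}"
    using assms by (metis empty_iff finite_cells mset_set_empty_iff)
  with False show ?thesis by (simp add: mcoeff_schur)
qed

lemma horizontal_strip_zero:
  assumes "is_partition \<mu>"
  shows "horizontal_strip \<mu> (\<lambda>_. 0) k \<longleftrightarrow> \<mu> = (\<lambda>_. 0) \<and> k = 0"
proof -
  have "is_partition (\<lambda>_. 0)" by (simp add: is_partition_def antimono_def)
  then show ?thesis
    using assms by (auto simp: horizontal_strip_def interlace_def fun_eq_iff skew_cells_def)
qed

text \<open>The induction is on a bound N for the variables in m. Extracting the largest variable
  makes the left side remove a strip from \<open>\<mu>\<close> before adding one, and the right side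
  add before removing; \<open>sum_local_rule\<close> exchanges the two orders.\<close>

theorem Pieri:
  assumes "is_partition \<mu>"
  shows "schur \<mu> * hsym k = (\<Sum>\<nu> | horizontal_strip \<mu> \<nu> k. schur \<nu>)"
proof (rule mpser_eqI)
  fix m
  have "mcoeff (schur \<mu> * hsym k) m = (\<Sum>\<nu> | horizontal_strip \<mu> \<nu> k. mcoeff (schur \<nu>) m)"
    if "\<And>x. x \<in># m \<Longrightarrow> x < N" "is_partition \<mu>" for N
    using that
  proof (induction N arbitrary: \<mu> k m)
    case 0
    then have m: "m = {#}" by (metis multiset_nonemptyE not_less0)
    have "{(a, b). a + b = ({#} :: nat multiset)} = {({#}, {#})}" by auto
    then have "mcoeff (schur \<mu> * hsym k) m = (if \<mu> = (\<lambda>_. 0) \<and> k = 0 then 1 else 0)"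
      using 0 by (simp add: m mcoeff_mult mcoeff_schur_empty mcoeff_hsym)
    also have "\<dots> = (\<Sum>\<nu> | horizontal_strip \<mu> \<nu> k. if \<nu> = (\<lambda>_. 0) then 1 else 0)"
      using horizontal_strip_zero[OF 0(2), of k] finite_horizontal_strip_outer[OF 0(2), of k]
      by simp
    also have "\<dots> = (\<Sum>\<nu> | horizontal_strip \<mu> \<nu> k. mcoeff (schur \<nu>) m)"
      by (intro sum.cong refl) (auto simp: m mcoeff_schur_empty horizontal_strip_def)
    finally show ?case .
  next
    case (Suc N)
    define j m' where "j = count m N" and "m' = filter_mset (\<lambda>x. x \<noteq> N) m"
    have m: "m = m' + replicate_mset j N"
      by (rule multiset_eqI) (simp add: j_def m'_def)
    have lt: "x < N" if "x \<in># m'" for x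
    proof -
      have "x \<in># m" "x \<noteq> N" using that by (simp_all add: m'_def)
      then show ?thesis using Suc.prems(1)[of x] by simp
    qed
    let ?I = "{p :: nat multiset \<times> nat multiset. fst p + snd p = m'}"
    \<comment> \<open>If i of the j copies of N go to the Schur factor, \<open>hsym k\<close> takes
      j - i of them and keeps degree \<open>i + k - j\<close>; the term vanishes when that would be
      negative.\<close>
    have row: "(\<Sum>p\<in>?I. mcoeff (schur \<mu>) (fst p + replicate_mset i N) *
          mcoeff (hsym k) (snd p + replicate_mset (j - i) N)) =
        (if j \<le> i + k then \<Sum>\<kappa> | horizontal_strip \<kappa> \<mu> i.
          \<Sum>\<rho> | horizontal_strip \<kappa> \<rho> (i + k - j). mcoeff (schur \<rho>) m' else 0)"
      if "i \<le> j" for i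
    proof (cases "j \<le> i + k")
      case True
      have "(\<Sum>p\<in>?I. mcoeff (schur \<mu>) (fst p + replicate_mset i N) *
          mcoeff (hsym k) (snd p + replicate_mset (j - i) N)) =
        (\<Sum>p\<in>?I. (\<Sum>\<kappa> | horizontal_strip \<kappa> \<mu> i. mcoeff (schur \<kappa>) (fst p)) *
          mcoeff (hsym (i + k - j)) (snd p))"
      proof (rule sum.cong[OF refl])
        fix p assume "p \<in> ?I"
        then have "x < N" if "x \<in># fst p" for x
          using lt[of x] that by auto
        then have "mcoeff (schur \<mu>) (fst p + replicate_mset i N) =
            (\<Sum>\<kappa> | horizontal_strip \<kappa> \<mu> i. mcoeff (schur \<kappa>) (fst p))"
          using Suc.prems(2) by (intro mcoeff_schur_remove_max)
        moreover have "mcoeff (hsym k) (snd p + replicate_mset (j - i) N) =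
            mcoeff (hsym (i + k - j)) (snd p)"
          using True \<open>i \<le> j\<close> by (auto simp: mcoeff_hsym)
        ultimately show "mcoeff (schur \<mu>) (fst p + replicate_mset i N) *
            mcoeff (hsym k) (snd p + replicate_mset (j - i) N) =
          (\<Sum>\<kappa> | horizontal_strip \<kappa> \<mu> i. mcoeff (schur \<kappa>) (fst p)) * mcoeff (hsym (i + k - j)) (snd p)"
          by simp
      qed
      also have "\<dots> = (\<Sum>p\<in>?I. \<Sum>\<kappa> | horizontal_strip \<kappa> \<mu> i.
          mcoeff (schur \<kappa>) (fst p) * mcoeff (hsym (i + k - j)) (snd p))"
        by (simp only: sum_distrib_right)
      also have "\<dots> = (\<Sum>\<kappa> | horizontal_strip \<kappa> \<mu> i. \<Sum>p\<in>?I.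
          mcoeff (schur \<kappa>) (fst p) * mcoeff (hsym (i + k - j)) (snd p))"
        by (rule sum.swap)
      also have "\<dots> = (\<Sum>\<kappa> | horizontal_strip \<kappa> \<mu> i. mcoeff (schur \<kappa> * hsym (i + k - j)) m')"
        by (simp add: mcoeff_mult case_prod_unfold)
      also have "\<dots> = (\<Sum>\<kappa> | horizontal_strip \<kappa> \<mu> i.
          \<Sum>\<rho> | horizontal_strip \<kappa> \<rho> (i + k - j). mcoeff (schur \<rho>) m')"
        by (intro sum.cong refl Suc.IH lt) (simp_all add: horizontal_strip_def)
      finally show ?thesis using True by simp
    next
      case False
      then have "mcoeff (hsym k) (b + replicate_mset (j - i) N) = 0" for b
        by (simp add: mcoeff_hsym)
      then show ?thesis using False by simp
    qed
    have "mcoeff (schur \<mu> * hsym k) m = (\<Sum>i\<le>j. if j \<le> i + k then \<Sum>\<kappa> | horizontal_strip \<kappa> \<mu> i.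
          \<Sum>\<rho> | horizontal_strip \<kappa> \<rho> (i + k - j). mcoeff (schur \<rho>) m' else 0)"
    proof -
      have "N \<notin># m'" by (simp add: m'_def)
      then show ?thesis
        unfolding m by (subst mcoeff_mult_replicate) (auto intro!: sum.cong row)
    qed
    also have "\<dots> = (\<Sum>i | i \<le> j \<and> j \<le> i + k. \<Sum>\<kappa> | horizontal_strip \<kappa> \<mu> i.
        \<Sum>\<rho> | horizontal_strip \<kappa> \<rho> (i + k - j). mcoeff (schur \<rho>) m')"
      by (simp only: atMost_def sum.inter_filter[of "{x. x \<le> j}" _ "\<lambda>i. j \<le> i + k", symmetric]
          finite_Collect_le_nat mem_Collect_eq)
    also have "\<dots> = (\<Sum>\<nu> | horizontal_strip \<mu> \<nu> k. \<Sum>\<rho> | horizontal_strip \<rho> \<nu> j. mcoeff (schur \<rho>) m')"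
      by (rule sum_local_rule[OF Suc.prems(2)])
    also have "\<dots> = (\<Sum>\<nu> | horizontal_strip \<mu> \<nu> k. mcoeff (schur \<nu>) m)"
      unfolding m using lt
      by (intro sum.cong refl mcoeff_schur_remove_max[symmetric]) (simp_all add: horizontal_strip_def)
    finally show ?case .
  qed
  moreover obtain N where "\<forall>x\<in>set_mset m. x < N"
    using finite_nat_set_iff_bounded[of "set_mset m"] by auto
  ultimately show "mcoeff (schur \<mu> * hsym k) m = mcoeff (\<Sum>\<nu> | horizontal_strip \<mu> \<nu> k. schur \<nu>) m"
    using assms by (auto simp: mcoeff_sum)
qed

section \<open>Symmetric functions\<close>

lemma sym_funI:
  assumes "\<And>\<pi> m. bij \<pi> \<Longrightarrow> mcoeff f (image_mset \<pi> m) = mcoeff f m" "\<And>m. mcoeff f m \<noteq> 0 \<Longrightarrow> size m \<le> d"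
  shows "f \<in> sym_fun"
  using assms unfolding sym_fun_def by blast

lemma sym_funE:
  assumes "f \<in> sym_fun"
  obtains d where "\<And>m. mcoeff f m \<noteq> 0 \<Longrightarrow> size m \<le> d"
  using assms unfolding sym_fun_def by blast

lemma sym_fun_image: "f \<in> sym_fun \<Longrightarrow> bij \<pi> \<Longrightarrow> mcoeff f (image_mset \<pi> m) = mcoeff f m"
  by (simp add: sym_fun_def)

lemma hsym_sym_fun [simp]: "hsym n \<in> sym_fun"
  by (rule sym_funI[of _ n]) (auto simp: mcoeff_hsym split: if_splits)

lemma zero_sym_fun [simp]: "0 \<in> sym_fun"
  by (rule sym_funI[of _ 0]) auto

lemma one_sym_fun [simp]: "1 \<in> sym_fun"
  using hsym_sym_fun[of 0] by (simp add: hsym_0)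

lemma add_sym_fun:
  assumes "f \<in> sym_fun" "g \<in> sym_fun"
  shows "f + g \<in> sym_fun"
proof -
  obtain d e where d: "\<And>m. mcoeff f m \<noteq> 0 \<Longrightarrow> size m \<le> d" and e: "\<And>m. mcoeff g m \<noteq> 0 \<Longrightarrow> size m \<le> e"
    using sym_funE[OF assms(1)] sym_funE[OF assms(2)] by metis
  show ?thesis
  proof (rule sym_funI)
    show "size m \<le> max d e" if "mcoeff (f + g) m \<noteq> 0" for m
      using that d[of m] e[of m] by (cases "mcoeff f m = 0") (auto simp: le_max_iff_disj)
  qed (simp add: assms sym_fun_image)
qed

lemma diff_sym_fun:
  assumes "f \<in> sym_fun" "g \<in> sym_fun"
  shows "f - g \<in> sym_fun"
proof -
  obtain d e where d: "\<And>m. mcoeff f m \<noteq> 0 \<Longrightarrow> size m \<le> d" and e: "\<And>m. mcoeff g m \<noteq> 0 \<Longrightarrow> size m \<le> e"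
    using sym_funE[OF assms(1)] sym_funE[OF assms(2)] by metis
  show ?thesis
  proof (rule sym_funI)
    show "size m \<le> max d e" if "mcoeff (f - g) m \<noteq> 0" for m
      using that d[of m] e[of m] by (cases "mcoeff f m = 0") (auto simp: le_max_iff_disj)
  qed (simp add: assms sym_fun_image)
qed

lemma mult_sym_fun:
  assumes "f \<in> sym_fun" "g \<in> sym_fun"
  shows "f * g \<in> sym_fun"
proof -
  obtain d e where d: "\<And>m. mcoeff f m \<noteq> 0 \<Longrightarrow> size m \<le> d" and e: "\<And>m. mcoeff g m \<noteq> 0 \<Longrightarrow> size m \<le> e"
    using sym_funE[OF assms(1)] sym_funE[OF assms(2)] by metis
  show ?thesis
  proof (rule sym_funI)
    fix \<pi> :: "nat \<Rightarrow> nat" and m assume \<pi>: "bij \<pi>"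
    then have inv: "inv \<pi> \<circ> \<pi> = id" "\<pi> \<circ> inv \<pi> = id"
      by (simp_all add: bij_is_inj bij_is_surj surj_iff[symmetric])
    have cancel: "image_mset (inv \<pi>) (image_mset \<pi> a) = a" "image_mset \<pi> (image_mset (inv \<pi>) a) = a" for a
      by (simp_all only: multiset.map_comp inv multiset.map_id)
    show "mcoeff (f * g) (image_mset \<pi> m) = mcoeff (f * g) m"
      unfolding mcoeff_mult
    proof (rule sum.reindex_bij_witness[where j = "\<lambda>(a, b). (image_mset (inv \<pi>) a, image_mset (inv \<pi>) b)"
          and i = "\<lambda>(a, b). (image_mset \<pi> a, image_mset \<pi> b)"], goal_cases)
      case (2 p)
      then show ?case
        using cancel(1)[of m] by (auto simp flip: image_mset_union)
    next
      case (5 p)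
      have "mcoeff f (image_mset (inv \<pi>) a) = mcoeff f a" "mcoeff g (image_mset (inv \<pi>) a) = mcoeff g a" for a
        using assms \<pi> by (simp_all add: sym_fun_image bij_imp_bij_inv)
      then show ?case by (simp add: case_prod_unfold)
    qed (auto simp: cancel)
  next
    fix m assume "mcoeff (f * g) m \<noteq> 0"
    then obtain p where "p \<in> {(a, b). a + b = m}" "(case p of (a, b) \<Rightarrow> mcoeff f a * mcoeff g b) \<noteq> 0"
      unfolding mcoeff_mult by (meson sum.neutral)
    then obtain a b where "a + b = m" "mcoeff f a \<noteq> 0" "mcoeff g b \<noteq> 0" by auto
    then show "size m \<le> d + e" using d[of a] e[of b] by auto
  qed
qed

lemma sum_sym_fun: "(\<And>x. x \<in> A \<Longrightarrow> f x \<in> sym_fun) \<Longrightarrow> sum f A \<in> sym_fun"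
  by (induction A rule: infinite_finite_induct) (auto intro: add_sym_fun)

lemma coeff_mult_sym_fun:
  assumes "\<And>i. coeff p i \<in> sym_fun" "\<And>i. coeff q i \<in> sym_fun"
  shows "coeff (p * q) i \<in> sym_fun"
  unfolding coeff_mult by (intro sum_sym_fun mult_sym_fun assms)

lemma coeff_power_sym_fun:
  assumes "\<And>i. coeff p i \<in> sym_fun"
  shows "coeff (p ^ k) i \<in> sym_fun"
proof (induction k arbitrary: i)
  case (Suc k)
  then show ?case unfolding power_Suc by (intro coeff_mult_sym_fun assms)
qed (simp add: one_pCons coeff_pCons split: nat.split)

section \<open>Schur expansion of ribbon functions\<close>

text \<open>
  The product formula for ribbons expresses a ribbon function through ribbon functions with fewer
  descents, down to the complete homogeneous functions.
\<close>

lemma ribbon_induct: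
  assumes "\<And>k. P (replicate k False)" "\<And>b c. P b \<Longrightarrow> P c \<Longrightarrow> P (b @ False # c) \<Longrightarrow> P (b @ True # c)"
  shows "P b"
proof (induction "count_list b True" arbitrary: b rule: less_induct)
  case less
  show ?case
  proof (cases "True \<in> set b")
    case True
    then obtain c d where b: "b = c @ True # d" by (meson split_list)
    show ?thesis unfolding b by (intro assms(2) less) (simp_all add: b)
  next
    case False
    then have "b = replicate (length b) False"
      by (metis (full_types) replicate_eqI)
    then show ?thesis using assms(1) by metis
  qed
qed

text \<open>Permuting the letters changes the descents of a word, so symmetry is obtained
  algebraically: \<open>ribbon_induct\<close> builds every ribbon function from the
  \<open>hsym n\<close> by products and differences.\<close>

lemma ribbon_fun_sym_fun: "ribbon_fun b \<in> sym_fun"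
proof (induction b rule: ribbon_induct)
  case (2 b c)
  have "ribbon_fun (b @ True # c) = ribbon_fun b * ribbon_fun c - ribbon_fun (b @ False # c)"
    by (simp add: ribbon_fun_mult)
  with 2 show ?case by (simp add: mult_sym_fun diff_sym_fun)
qed (simp add: ribbon_fun_hsym)

section \<open>Row words of standard tableaux\<close>

definition add_rows :: "(nat \<Rightarrow> nat) \<Rightarrow> nat list \<Rightarrow> nat \<Rightarrow> nat" where
  "add_rows \<mu> rs = (\<lambda>i. \<mu> i + count_list rs i)"

text \<open>
  A lattice word lists the rows of the entries of a standard tableau of skew shape, so that its
  ascents are the descents of the tableau.
\<close>

fun lattice_word :: "(nat \<Rightarrow> nat) \<Rightarrow> nat list \<Rightarrow> bool" where
  "lattice_word \<mu> [] \<longleftrightarrow> is_partition \<mu>"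
| "lattice_word \<mu> (r # rs) \<longleftrightarrow> is_partition \<mu> \<and> lattice_word (\<mu>(r := Suc (\<mu> r))) rs"

lemma add_rows_Nil [simp]: "add_rows \<mu> [] = \<mu>"
  by (simp add: add_rows_def)

lemma add_rows_Cons: "add_rows (\<mu>(r := Suc (\<mu> r))) rs = add_rows \<mu> (r # rs)"
  by (auto simp: add_rows_def)

lemma add_rows_append: "add_rows \<mu> (rs @ ss) = add_rows (add_rows \<mu> rs) ss"
  by (auto simp: add_rows_def)

lemma lattice_word_partition: "lattice_word \<mu> rs \<Longrightarrow> is_partition \<mu> \<and> is_partition (add_rows \<mu> rs)"
proof (induction rs arbitrary: \<mu>)
  case (Cons r rs)
  then show ?case
    using Cons.IH[of "\<mu>(r := Suc (\<mu> r))"] unfolding lattice_word.simps add_rows_Cons by blast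
qed simp

lemma lattice_word_append:
  "lattice_word \<mu> (rs @ ss) \<longleftrightarrow> lattice_word \<mu> rs \<and> lattice_word (add_rows \<mu> rs) ss"
proof (induction rs arbitrary: \<mu>)
  case Nil
  show ?case using lattice_word_partition[of \<mu> ss] by auto
qed (auto simp: add_rows_Cons)

lemma finite_lattice_words: "finite {rs. lattice_word \<mu> rs \<and> length rs = n}"
proof (induction n arbitrary: \<mu>)
  case 0
  have "{rs. lattice_word \<mu> rs \<and> length rs = 0} \<subseteq> {[]}" by auto
  then show ?case by (rule finite_subset) simp
next
  case (Suc n)
  let ?\<mu> = "\<lambda>r. \<mu>(r := Suc (\<mu> r))"
  show ?case
  proof (cases "is_partition \<mu>")
    case True
    then obtain L where L: "\<And>i. L \<le> i \<Longrightarrow> \<mu> i = 0" using partition_bound by blast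
    \<comment> \<open>A cell in a row beyond L would lie below an empty row.\<close>
    have r_le: "r \<le> L" if r: "is_partition (?\<mu> r)" for r
    proof (rule ccontr)
      assume "\<not> r \<le> L"
      then obtain q where q: "r = Suc q" "L \<le> q" by (cases r) auto
      have "?\<mu> r (Suc q) \<le> ?\<mu> r q" using partition_antimono[OF r, of q "Suc q"] by simp
      then show False using q L[of q] by simp
    qed
    have "{rs. lattice_word \<mu> rs \<and> length rs = Suc n} \<subseteq>
        (\<Union>r\<in>{..L}. (\<lambda>rs. r # rs) ` {rs. lattice_word (?\<mu> r) rs \<and> length rs = n})"
    proof
      fix rs assume "rs \<in> {rs. lattice_word \<mu> rs \<and> length rs = Suc n}"
      then obtain r ss where rs: "rs = r # ss" "lattice_word (?\<mu> r) ss" "length ss = n"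
        by (cases rs) auto
      then have "r \<le> L" using r_le lattice_word_partition by blast
      with rs show "rs \<in> (\<Union>r\<in>{..L}. (\<lambda>rs. r # rs) ` {rs. lattice_word (?\<mu> r) rs \<and> length rs = n})"
        by blast
    qed
    then show ?thesis by (rule finite_subset) (simp add: Suc.IH)
  next
    case False
    then have "{rs. lattice_word \<mu> rs \<and> length rs = Suc n} = {}"
      using lattice_word_partition by blast
    then show ?thesis by (simp only: finite.emptyI)
  qed
qed

definition lattice_words :: "(nat \<Rightarrow> nat) \<Rightarrow> bool list \<Rightarrow> nat list set" where
  "lattice_words \<mu> b = {rs \<in> words (<) b. lattice_word \<mu> rs}"

lemma finite_lattice_words_pattern: "finite (lattice_words \<mu> b)"
proof (rule finite_subset)
  show "lattice_words \<mu> b \<subseteq> {rs. lattice_word \<mu> rs \<and> length rs = Suc (length b)}"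
    using words_length by (auto simp: lattice_words_def)
qed (rule finite_lattice_words)

text \<open>The counterpart of \<open>ribbon_fun_mult\<close>: a lattice word may be cut anywhere if
  its second part starts from the shape that the first part reaches.\<close>

lemma sum_lattice_words_append:
  "(\<Sum>u\<in>lattice_words \<mu> b. \<Sum>v\<in>lattice_words (add_rows \<mu> u) c. f (add_rows (add_rows \<mu> u) v)) =
    (\<Sum>w\<in>lattice_words \<mu> (b @ True # c). f (add_rows \<mu> w)) +
    (\<Sum>w\<in>lattice_words \<mu> (b @ False # c). f (add_rows \<mu> w))"
proof -
  let ?A = "SIGMA u:lattice_words \<mu> b. lattice_words (add_rows \<mu> u) c"
  let ?B = "{w \<in> \<Union>d. words (<) (b @ d # c). lattice_word \<mu> w}"
  have "(\<Sum>u\<in>lattice_words \<mu> b. \<Sum>v\<in>lattice_words (add_rows \<mu> u) c. f (add_rows (add_rows \<mu> u) v)) =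
      (\<Sum>(u, v)\<in>?A. f (add_rows (add_rows \<mu> u) v))"
    by (intro sum.Sigma finite_lattice_words_pattern ballI)
  also have "\<dots> = (\<Sum>p\<in>?A. f (add_rows \<mu> (case p of (u, v) \<Rightarrow> u @ v)))"
    by (intro sum.cong refl) (simp add: case_prod_unfold add_rows_append)
  also have "\<dots> = (\<Sum>w\<in>?B. f (add_rows \<mu> w))"
  proof (rule sum.reindex_bij_betw)
    have "?A = {p \<in> words (<) b \<times> words (<) c. lattice_word \<mu> (case p of (u, v) \<Rightarrow> u @ v)}"
      by (auto simp: lattice_words_def lattice_word_append)
    then show "bij_betw (\<lambda>(u, v). u @ v) ?A ?B"
      using bij_betw_Collect[OF bij_betw_append_words, of "(<)" b c "lattice_word \<mu>"
          "\<lambda>p. lattice_word \<mu> (case p of (u, v) \<Rightarrow> u @ v)"] by simp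
  qed
  also have "?B = lattice_words \<mu> (b @ True # c) \<union> lattice_words \<mu> (b @ False # c)"
    by (auto simp: lattice_words_def UNIV_bool)
  also have "(\<Sum>w\<in>\<dots>. f (add_rows \<mu> w)) = (\<Sum>w\<in>lattice_words \<mu> (b @ True # c). f (add_rows \<mu> w)) +
      (\<Sum>w\<in>lattice_words \<mu> (b @ False # c). f (add_rows \<mu> w))"
    by (intro sum.union_disjoint finite_lattice_words_pattern) (auto simp: lattice_words_def words_def)
  finally show ?thesis .
qed

text \<open>The rows are filled from the bottom upwards, so row i + 1 is complete while row i still
  has its original length. All intermediate shapes are partitions iff the final row i + 1 never
  exceeds the original row i.\<close>

lemma lattice_word_decreasing:
  assumes "sorted (rev rs)" "is_partition \<mu>"
  shows "lattice_word \<mu> rs \<longleftrightarrow> interlace \<mu> (add_rows \<mu> rs)"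
  using assms
proof (induction rs arbitrary: \<mu>)
  case Nil
  then show ?case using partition_antimono[of \<mu>] by (simp add: interlace_def)
next
  case (Cons r rs)
  let ?\<mu> = "\<mu>(r := Suc (\<mu> r))" and ?\<nu> = "add_rows \<mu> (r # rs)"
  have sorted: "sorted (rev rs)" and le: "\<And>x. x \<in> set rs \<Longrightarrow> x \<le> r"
    using Cons.prems(1) by (auto simp: sorted_append)
  \<comment> \<open>The letters after r are at most r, so row r + 1 does not grow any more.\<close>
  have cnt: "count_list rs (Suc r) = 0" using le[of "Suc r"] by (auto simp: count_list_0_iff)
  have anti: "\<mu> (Suc i) \<le> \<mu> i" for i using partition_antimono[OF Cons.prems(2)] by simp
  have IH: "lattice_word ?\<mu> rs \<longleftrightarrow> is_partition ?\<mu> \<and> interlace ?\<mu> ?\<nu>"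
    using Cons.IH[OF sorted, of ?\<mu>, unfolded add_rows_Cons] lattice_word_partition[of ?\<mu> rs] by blast
  have "is_partition ?\<mu> \<and> interlace ?\<mu> ?\<nu> \<longleftrightarrow> interlace \<mu> ?\<nu>"
  proof
    assume h: "is_partition ?\<mu> \<and> interlace ?\<mu> ?\<nu>"
    have "?\<nu> (Suc i) \<le> \<mu> i" for i
    proof (cases "i = r")
      case True
      then show ?thesis using anti[of r] cnt by (simp add: add_rows_def)
    next
      case False
      have "?\<nu> (Suc i) \<le> ?\<mu> i" using h unfolding interlace_def by blast
      then show ?thesis using False by simp
    qed
    then show "interlace \<mu> ?\<nu>" by (simp add: interlace_def add_rows_def)
  next
    assume h: "interlace \<mu> ?\<nu>"
    then have up: "?\<nu> (Suc i) \<le> \<mu> i" for i by (simp add: interlace_def)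
    have "?\<nu> (Suc i) \<le> ?\<mu> i" for i using up[of i] by auto
    moreover have low: "?\<mu> i \<le> ?\<nu> i" for i by (auto simp: add_rows_def)
    ultimately have "interlace ?\<mu> ?\<nu>" by (simp only: interlace_def simp_thms)
    moreover from this have "is_partition ?\<mu>"
    proof (rule interlace_partition)
      have "{i. ?\<mu> i \<noteq> 0} \<subseteq> insert r {i. \<mu> i \<noteq> 0}" by auto
      then have "finite {i. ?\<mu> i \<noteq> 0}"
        by (rule finite_subset) (use Cons.prems(2) in \<open>simp add: is_partition_def\<close>)
      then show "finite {i. ?\<mu> i \<noteq> 0} \<or> finite {i. ?\<nu> i \<noteq> 0}" ..
    qed
    ultimately show "is_partition ?\<mu> \<and> interlace ?\<mu> ?\<nu>" by blast
  qed
  then show ?case using IH Cons.prems(2) by simp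
qed

lemma card_cells_add_rows:
  assumes "is_partition \<mu>"
  shows "card (cells (add_rows \<mu> rs)) = card (cells \<mu>) + length rs"
proof -
  obtain L where L: "\<And>i. L \<le> i \<Longrightarrow> \<mu> i = 0" using partition_bound[OF assms] by blast
  obtain M where M: "\<forall>i\<in>set rs. i < M" using finite_nat_set_iff_bounded[of "set rs"] by auto
  let ?K = "max L M"
  have rs0: "count_list rs i = 0" if "?K \<le> i" for i
    using M that by (auto simp: count_list_0_iff)
  have "card (cells (add_rows \<mu> rs)) = (\<Sum>i<?K. \<mu> i) + (\<Sum>i<?K. count_list rs i)"
    using card_cells[of ?K "add_rows \<mu> rs"] L rs0 by (simp add: add_rows_def sum.distrib)
  also have "(\<Sum>i<?K. \<mu> i) = card (cells \<mu>)"
    using card_cells[of ?K \<mu>] L by simp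
  also have "(\<Sum>i<?K. count_list rs i) = length rs"
    using M by (intro sum_count_set) auto
  finally show ?thesis .
qed

lemma words_decreasing:
  "words (<) (replicate k False) = {rs :: nat list. length rs = Suc k \<and> sorted (rev rs)}"
  by (auto simp: words_eq_nth sorted_rev_iff_nth_Suc not_less)

text \<open>A strip prescribes how often each row occurs, and a weakly decreasing word is determined
  by these multiplicities. This matches the base case of \<open>ribbon_induct\<close> with the Pieri
  rule.\<close>

lemma bij_betw_decreasing_lattice_words:
  assumes \<mu>: "is_partition \<mu>"
  shows "bij_betw (add_rows \<mu>) (lattice_words \<mu> (replicate k False)) {\<nu>. horizontal_strip \<mu> \<nu> (Suc k)}"
proof (rule bij_betw_imageI)
  show "inj_on (add_rows \<mu>) (lattice_words \<mu> (replicate k False))"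
  proof (rule inj_onI)
    fix u v assume u: "u \<in> lattice_words \<mu> (replicate k False)" and v: "v \<in> lattice_words \<mu> (replicate k False)"
      and eq: "add_rows \<mu> u = add_rows \<mu> v"
    have "count_list u i = count_list v i" for i
      using fun_cong[OF eq, of i] by (simp add: add_rows_def)
    then have "mset (rev u) = mset (rev v)"
      by (intro multiset_eqI) (simp flip: count_mset)
    moreover have "sorted (rev u)" "sorted (rev v)"
      using u v by (simp_all add: lattice_words_def words_decreasing)
    ultimately have "rev u = rev v" by (metis sorted_sort_id sort_key_eq_sort_key properties_for_sort)
    then show "u = v" by simp
  qed
  show "add_rows \<mu> ` lattice_words \<mu> (replicate k False) = {\<nu>. horizontal_strip \<mu> \<nu> (Suc k)}"
  proof (intro equalityI subsetI)
    fix \<nu> assume "\<nu> \<in> add_rows \<mu> ` lattice_words \<mu> (replicate k False)"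
    then obtain rs where rs: "\<nu> = add_rows \<mu> rs" "length rs = Suc k" "sorted (rev rs)" "lattice_word \<mu> rs"
      by (auto simp: lattice_words_def words_decreasing)
    then show "\<nu> \<in> {\<nu>. horizontal_strip \<mu> \<nu> (Suc k)}"
      using lattice_word_partition[OF rs(4)] lattice_word_decreasing[OF rs(3) \<mu>] card_cells_add_rows[OF \<mu>]
      by (simp add: horizontal_strip_def)
  next
    fix \<nu> assume "\<nu> \<in> {\<nu>. horizontal_strip \<mu> \<nu> (Suc k)}"
    then have h: "horizontal_strip \<mu> \<nu> (Suc k)" by simp
    then have le: "\<mu> i \<le> \<nu> i" for i by (simp add: horizontal_strip_def interlace_def)
    define M where "M = Abs_multiset (\<lambda>i. \<nu> i - \<mu> i)"
    have "finite {i. \<nu> i \<noteq> 0}" using h by (simp add: horizontal_strip_def is_partition_def)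
    then have "finite {i. \<nu> i - \<mu> i > 0}" by (rule rev_finite_subset) auto
    then have M: "count M i = \<nu> i - \<mu> i" for i by (simp add: M_def count_Abs_multiset)
    define rs where "rs = rev (sorted_list_of_multiset M)"
    have cnt: "count_list rs i = \<nu> i - \<mu> i" for i
      unfolding rs_def by (simp add: M flip: count_mset)
    have add: "add_rows \<mu> rs = \<nu>"
      using le by (auto simp: add_rows_def cnt)
    have "sorted (rev rs)" by (simp add: rs_def)
    moreover have "length rs = Suc k"
      using card_cells_add_rows[OF \<mu>, of rs] h by (simp add: add horizontal_strip_def)
    ultimately have "rs \<in> lattice_words \<mu> (replicate k False)"
      using lattice_word_decreasing[OF _ \<mu>, of rs] h
      by (simp add: lattice_words_def words_decreasing add horizontal_strip_def)
    then show "\<nu> \<in> add_rows \<mu> ` lattice_words \<mu> (replicate k False)"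
      using add by blast
  qed
qed

text \<open>The shape \<open>\<mu>\<close> is arbitrary because, after a cut, the second ribbon
  multiplies the Schur functions of all shapes reached by the first. The empty shape then gives the
  expansion of the ribbon function itself.\<close>

theorem schur_mult_ribbon_fun:
  "is_partition \<mu> \<Longrightarrow> schur \<mu> * ribbon_fun b = (\<Sum>rs\<in>lattice_words \<mu> b. schur (add_rows \<mu> rs))"
proof (induction b arbitrary: \<mu> rule: ribbon_induct)
  case (1 k)
  have "schur \<mu> * ribbon_fun (replicate k False) = (\<Sum>\<nu> | horizontal_strip \<mu> \<nu> (Suc k). schur \<nu>)"
    using 1 by (simp add: ribbon_fun_hsym Pieri)
  also have "\<dots> = (\<Sum>rs\<in>lattice_words \<mu> (replicate k False). schur (add_rows \<mu> rs))"
    by (rule sum.reindex_bij_betw[OF bij_betw_decreasing_lattice_words[OF 1], symmetric])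
  finally show ?case .
next
  case (2 b c)
  have "schur \<mu> * ribbon_fun (b @ True # c) =
      schur \<mu> * ribbon_fun b * ribbon_fun c - schur \<mu> * ribbon_fun (b @ False # c)"
    by (simp add: ribbon_fun_mult mult.assoc distrib_left)
  also have "schur \<mu> * ribbon_fun b * ribbon_fun c =
      (\<Sum>u\<in>lattice_words \<mu> b. schur (add_rows \<mu> u) * ribbon_fun c)"
    by (simp add: 2 sum_distrib_right)
  also have "\<dots> = (\<Sum>u\<in>lattice_words \<mu> b. \<Sum>v\<in>lattice_words (add_rows \<mu> u) c. schur (add_rows (add_rows \<mu> u) v))"
  proof (intro sum.cong refl "2.IH"(2))
    fix u assume "u \<in> lattice_words \<mu> b"
    then show "is_partition (add_rows \<mu> u)"
      using lattice_word_partition by (auto simp: lattice_words_def)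
  qed
  finally show ?case
    unfolding sum_lattice_words_append by (simp add: 2)
qed

section \<open>Schur positivity\<close>

lemma schur_zero: "schur (\<lambda>_. 0) = 1"
proof (rule mpser_eqI)
  fix m
  have "cells (\<lambda>_. 0) = {}" by (simp add: skew_cells_def)
  moreover have "ssyt {} = {\<lambda>_. undefined}" by (auto simp: ssyt_def)
  ultimately show "mcoeff (schur (\<lambda>_. 0)) m = mcoeff 1 m"
    by (auto simp: mcoeff_schur mcoeff_one)
qed

lemma ribbon_fun_schur: "ribbon_fun b = (\<Sum>rs\<in>lattice_words (\<lambda>_. 0) b. schur (add_rows (\<lambda>_. 0) rs))"
proof -
  have "is_partition (\<lambda>_. 0)" by (simp add: is_partition_def antimono_def)
  from schur_mult_ribbon_fun[OF this, of b] show ?thesis by (simp add: schur_zero)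
qed

text \<open>Different words may end in the same shape; the multiplicities become the
  coefficients.\<close>

lemma schur_positive_sum:
  assumes "finite I" "\<And>i. i \<in> I \<Longrightarrow> is_partition (l i)" "(\<Sum>i\<in>I. schur (l i)) \<in> sym_fun"
  shows "schur_positive (\<Sum>i\<in>I. schur (l i))"
proof -
  have "(\<Sum>i\<in>I. schur (l i)) = (\<Sum>\<nu>\<in>l ` I. \<Sum>i | i \<in> I \<and> l i = \<nu>. schur (l i))"
    by (rule sum.image_gen[OF assms(1)])
  also have "\<dots> = (\<Sum>\<nu>\<in>l ` I. real (card {i \<in> I. l i = \<nu>}) *\<^sub>R schur \<nu>)"
  proof (rule sum.cong[OF refl])
    fix \<nu>
    have "(\<Sum>i | i \<in> I \<and> l i = \<nu>. schur (l i)) = (\<Sum>i | i \<in> I \<and> l i = \<nu>. schur \<nu>)"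
      by (rule sum.cong) auto
    then show "(\<Sum>i | i \<in> I \<and> l i = \<nu>. schur (l i)) = real (card {i \<in> I. l i = \<nu>}) *\<^sub>R schur \<nu>"
      by (simp add: scaleR_conv_of_real)
  qed
  finally have "(\<Sum>i\<in>I. schur (l i)) = (\<Sum>\<nu>\<in>l ` I. real (card {i \<in> I. l i = \<nu>}) *\<^sub>R schur \<nu>)" .
  then show ?thesis
    unfolding schur_positive_def using assms
    by (intro conjI exI[of _ "l ` I"] exI[of _ "\<lambda>\<nu>. real (card {i \<in> I. l i = \<nu>})"]) auto
qed

lemma schur_positive_gamma_tilde:
  assumes "0 < n"
  shows "schur_positive (gamma_tilde n k)"
proof -
  let ?B = "{b. b \<in> hook_patterns n \<and> count_list b True = k}"
  let ?I = "SIGMA b:?B. lattice_words (\<lambda>_. 0) b"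
  let ?l = "\<lambda>p. add_rows (\<lambda>_. 0) (snd p)"
  have fin: "finite ?B" by (rule finite_subset[OF _ finite_hook_patterns[of n]]) auto
  have "gamma_tilde n k = (\<Sum>b\<in>?B. \<Sum>rs\<in>lattice_words (\<lambda>_. 0) b. schur (add_rows (\<lambda>_. 0) rs))"
    by (simp add: gamma_tilde_eq[OF assms] flip: ribbon_fun_schur)
  also have "\<dots> = (\<Sum>(b, rs)\<in>?I. schur (add_rows (\<lambda>_. 0) rs))"
    by (intro sum.Sigma fin ballI finite_lattice_words_pattern)
  finally have eq: "gamma_tilde n k = (\<Sum>p\<in>?I. schur (?l p))"
    by (simp add: case_prod_unfold)
  have sym: "gamma_tilde n k \<in> sym_fun"
    unfolding gamma_tilde_eq[OF assms] by (intro sum_sym_fun ribbon_fun_sym_fun)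
  show ?thesis
    unfolding eq
  proof (rule schur_positive_sum)
    show "finite ?I" by (intro finite_SigmaI fin finite_lattice_words_pattern)
    show "is_partition (?l p)" if "p \<in> ?I" for p
      using that lattice_word_partition by (auto simp: lattice_words_def)
    show "(\<Sum>p\<in>?I. schur (?l p)) \<in> sym_fun" using sym eq by simp
  qed
qed

theorem theorem3p4:
  fixes n :: nat
  assumes "n \<ge> 1"
  shows "Qtilde n =
           (\<Sum>k=0..n div 2. smult (gamma_tilde n k) (tvar ^ k * (1 + tvar) ^ (n - 2 * k)))
         \<and> schur_gamma_positive (Qtilde n)"
proof -
  have n: "0 < n" using assms by simp
  have eq: "Qtilde n = (\<Sum>k=0..n div 2. smult (gamma_tilde n k) (tvar ^ k * (1 + tvar) ^ (n - 2 * k)))"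
    unfolding Qtilde_eq_hook_poly by (rule hook_poly_eq_gamma[OF n])
  have t: "coeff tvar i \<in> sym_fun" and t1: "coeff (1 + tvar) i \<in> sym_fun" for i
    by (auto simp: coeff_pCons one_pCons split: nat.split)
  \<comment> \<open>Membership of the coefficients in \<Lambda> is read off from the
    \<gamma>-expansion, as symmetric functions are closed under sums and products.\<close>
  have "coeff (Qtilde n) i \<in> sym_fun" for i
    unfolding eq coeff_sum coeff_smult
  proof (intro sum_sym_fun mult_sym_fun coeff_mult_sym_fun coeff_power_sym_fun t t1)
    show "gamma_tilde n k \<in> sym_fun" for k
      using schur_positive_gamma_tilde[OF n] by (simp add: schur_positive_def)
  qed
  then have "schur_gamma_positive (Qtilde n)"
    unfolding schur_gamma_positive_def using eq schur_positive_gamma_tilde[OF n] by blast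
  with eq show ?thesis ..
qed

end
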